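(* Let $p\ge 3$ and $q\ge 1$ be integers. For all sufficiently large $n$, we have $Y_p(n)\in \mathcal{G}(n,p,1)\subseteq \mathcal{G}(n,p,q)$.
   Context: For integers $p\ge 2$, $q\ge 1$, the complete split graph (generalized book graph) is $B_{p,q}=K_p\nabla qK_1$, the join of a clique $K_p$ with an independent set of $q$ vertices (every vertex of the $K_p$ adjacent to every one of the $q$ vertices). A graph is non-$p$-partite if its chromatic number exceeds $p$. $\mathcal{G}(n,p,q)$ denotes the set of graphs with the largest number of edges among all $n$-vertex non-$p$-partite $B_{p,q}$-free graphs (graphs containing no subgraph isomorphic to $B_{p,q}$). $T_{m,p}$ denotes the Turán graph, the complete $p$-partite graph on $m$ vertices with part sizes as equal as possible. The graph $Y_p(n)$ is defined as follows: let $T_1,\dots,T_p$ be the color classes of $T_{n-1,p}$ with $\lfloor\frac{n-1}{p}\rfloor=|T_1|\le |T_2|\le\cdots\le |T_p|=\lceil\frac{n-1}{p}\rceil$, pick $u_1\in T_1$, $u_2\in T_2$; $Y_p(n)$ is obtained from $T_{n-1,p}$ by deleting the edge $u_1u_2$ and adding a new vertex $u_0$ adjacent to all vertices of $(T_3\cup\cdots\cup T_p)\cup\{u_1,u_2\}$. *)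

theory Defs
  imports Main
begin

text \<open>Simple graphs on the vertex set {0..<n}, given by their edge set
  (a set of 2-element subsets of {0..<n}).  Graphs are labelled; since all notions
  below are isomorphism invariant, this matches the paper's unlabelled graphs.\<close>

definition graph_on :: "nat \<Rightarrow> nat set set \<Rightarrow> bool" where
  "graph_on n E \<longleftrightarrow> E \<subseteq> {{u, v} | u v. u \<noteq> v \<and> u < n \<and> v < n}"

definition p_partite :: "nat \<Rightarrow> nat \<Rightarrow> nat set set \<Rightarrow> bool" where
  "p_partite n p E \<longleftrightarrow>
     (\<exists>c :: nat \<Rightarrow> nat. (\<forall>v<n. c v < p) \<and> (\<forall>u v. {u, v} \<in> E \<longrightarrow> c u \<noteq> c v))"

definition non_p_partite :: "nat \<Rightarrow> nat \<Rightarrow> nat set set \<Rightarrow> bool" where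
  "non_p_partite n p E \<longleftrightarrow> \<not> p_partite n p E"

text \<open>B_{p,q} = K_p join qK_1, on vertices 0..<p+q: vertices 0..<p form the clique,
  vertices p..<p+q the independent set.  The graph contains B_{p,q} as a (not
  necessarily induced) subgraph iff there is an injective map f of {0..<p+q} into
  the vertex set such that every edge of B_{p,q} is mapped to an edge.\<close>
definition contains_book :: "nat \<Rightarrow> nat \<Rightarrow> nat \<Rightarrow> nat set set \<Rightarrow> bool" where
  "contains_book n p q E \<longleftrightarrow>
     (\<exists>f. inj_on f {0..<p+q} \<and> f ` {0..<p+q} \<subseteq> {0..<n} \<and>
          (\<forall>i j. i < p \<and> j < p + q \<and> i \<noteq> j \<longrightarrow> {f i, f j} \<in> E))"

definition book_free :: "nat \<Rightarrow> nat \<Rightarrow> nat \<Rightarrow> nat set set \<Rightarrow> bool" where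
  "book_free n p q E \<longleftrightarrow> \<not> contains_book n p q E"

definition extremal :: "nat \<Rightarrow> nat \<Rightarrow> nat \<Rightarrow> nat set set set" where
  "extremal n p q =
     {E. graph_on n E \<and> non_p_partite n p E \<and> book_free n p q E \<and>
         (\<forall>E'. graph_on n E' \<and> non_p_partite n p E' \<and> book_free n p q E'
                 \<longrightarrow> card E' \<le> card E)}"

text \<open>Y_p(n), on vertices 0..<n.  Vertex 0 is u_0.  The vertices 1..n-1 carry the
  Turan graph T_{n-1,p}: vertex v lies in the class with residue (v-1) mod p.
  Classes with larger residue are not larger, so T_1 is the class of residue p-1
  and T_2 the class of residue p-2 (|T_1| <= |T_2| <= ... <= |T_p|).
  We pick u_1 = p (residue p-1) and u_2 = p-1 (residue p-2); these exist when
  n - 1 \<ge> p.\<close>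
definition tpart :: "nat \<Rightarrow> nat \<Rightarrow> nat" where
  "tpart p v = (v - 1) mod p"

definition Y_graph :: "nat \<Rightarrow> nat \<Rightarrow> nat set set" where
  "Y_graph p n =
     {{u, v} | u v. 1 \<le> u \<and> u < n \<and> 1 \<le> v \<and> v < n \<and> tpart p u \<noteq> tpart p v
                 \<and> {u, v} \<noteq> {p, p - 1}}
     \<union> {{0, v} | v. 1 \<le> v \<and> v < n \<and>
                 ((tpart p v \<noteq> p - 1 \<and> tpart p v \<noteq> p - 2) \<or> v = p \<or> v = p - 1)}"

end

theory Submission
  imports Defs
begin

text \<open>
  A graph without \<open>B_{p,q}\<close> is close to \<open>p\<close>-partite: picking a vertex \<open>x\<close> of maximum
  degree, splitting off its non-neighbours as one class and recursing into the
  \<open>B_{p-1,q}\<close>-free neighbourhood of \<open>x\<close> (Furedi's proof of stability) gives a partition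
  with at most \<open>e(K) - e(G) + O(n)\<close> edges inside the classes, where \<open>K\<close> is the complete
  multipartite graph on it. If \<open>G\<close> has as many edges as \<open>Y_p(n)\<close>, take a partition with
  the fewest inner edges. All classes then have about \<open>n/p\<close> vertices, all but boundedly
  many vertices miss few cross edges, and a clique \<open>X\<close> whose vertices have many common
  neighbours in each of \<open>p + 1 - |X|\<close> classes extends greedily to a book. Applied to an
  inner edge \<open>ab\<close> this shows that \<open>a\<close> and \<open>b\<close> together miss almost a whole class, and
  there is no budget for more: every other vertex misses few cross edges. So either \<open>ab\<close>
  is the only inner edge and \<open>a\<close>, \<open>b\<close> have no common neighbour in some class, or all
  inner edges form a star at some \<open>w\<close>. In the latter case \<open>w\<close> has few neighbours in
  another class \<open>V_i\<close>, and since \<open>p \<ge> 3\<close> there is no edge between the \<open>d \<ge> 1\<close> neighbours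
  of \<open>w\<close> in its own class and the \<open>d_i \<ge> d\<close> ones in \<open>V_i\<close>. Hence at least
  \<open>|V_i| - d_i + d d_i \<ge> |V_i| + d - 1\<close> cross edges are missing, against \<open>d\<close> inner ones.
  In both cases \<open>e(G) \<le> e(K) - |V_i| + 1 \<le> e(Y_p(n))\<close>. All counts are over ordered
  pairs, which doubles every number of edges.
\<close>

section \<open>Stability\<close>

definition pc :: "('a \<Rightarrow> 'a \<Rightarrow> bool) \<Rightarrow> 'a set \<Rightarrow> 'a set \<Rightarrow> nat" where
  "pc P X Y = card {(u, v). u \<in> X \<and> v \<in> Y \<and> P u v}"

lemma finite_pc: "finite X \<Longrightarrow> finite Y \<Longrightarrow> finite {(u, v). u \<in> X \<and> v \<in> Y \<and> P u v}"
  by (rule finite_subset[of _ "X \<times> Y"]) auto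

lemma pc_sum:
  assumes "finite X" "finite Y"
  shows "pc P X Y = (\<Sum>u\<in>X. card {v \<in> Y. P u v})"
proof -
  have "{(u, v). u \<in> X \<and> v \<in> Y \<and> P u v} = Sigma X (\<lambda>u. {v \<in> Y. P u v})" by auto
  then show ?thesis using assms by (simp add: pc_def)
qed

lemma pc_Un_left:
  assumes "finite X" "finite X'" "finite Y" "X \<inter> X' = {}"
  shows "pc P (X \<union> X') Y = pc P X Y + pc P X' Y"
  using assms by (simp add: pc_sum sum.union_disjoint)

lemma pc_swap: "pc P X Y = pc (\<lambda>u v. P v u) Y X"
proof -
  have "{(u, v). u \<in> X \<and> v \<in> Y \<and> P u v} = prod.swap ` {(u, v). u \<in> Y \<and> v \<in> X \<and> P v u}"
    by auto
  then show ?thesis by (simp add: pc_def card_image)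
qed

lemma pc_commute:
  assumes "\<And>u v. P u v \<Longrightarrow> P v u"
  shows "pc P X Y = pc P Y X"
proof -
  have "(\<lambda>u v. P v u) = P" using assms by blast
  then show ?thesis using pc_swap[of P X Y] by simp
qed

lemma pc_Un_right:
  assumes "finite X" "finite Y'" "finite Y" "Y \<inter> Y' = {}"
  shows "pc P X (Y \<union> Y') = pc P X Y + pc P X Y'"
  using assms pc_Un_left[of Y Y' X "\<lambda>u v. P v u"] by (simp add: pc_swap[of P])

lemma pc_Un_self:
  assumes "finite X" "finite Y" "X \<inter> Y = {}" and sym: "\<And>u v. P u v \<Longrightarrow> P v u"
  shows "pc P (X \<union> Y) (X \<union> Y) = pc P X X + 2 * pc P X Y + pc P Y Y"
proof -
  have "pc P Y X = pc P X Y"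
    using sym by (rule pc_commute)
  then show ?thesis using assms by (simp add: pc_Un_left pc_Un_right)
qed

lemma pc_cong:
  "(\<And>u v. u \<in> X \<Longrightarrow> v \<in> Y \<Longrightarrow> P u v = Q u v) \<Longrightarrow> pc P X Y = pc Q X Y"
  unfolding pc_def by (rule arg_cong[where f = card]) auto

lemma pc_split:
  assumes "finite X" "finite Y"
  shows "pc P X Y = pc (\<lambda>u v. P u v \<and> Q u v) X Y + pc (\<lambda>u v. P u v \<and> \<not> Q u v) X Y"
proof -
  have "{(u, v). u \<in> X \<and> v \<in> Y \<and> P u v} =
      {(u, v). u \<in> X \<and> v \<in> Y \<and> P u v \<and> Q u v} \<union> {(u, v). u \<in> X \<and> v \<in> Y \<and> P u v \<and> \<not> Q u v}"
    by auto
  then show ?thesis unfolding pc_def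
    using finite_pc[OF assms] by (subst card_Un_disjoint[symmetric]) auto
qed

text \<open>Both sides count inner edges, cross edges and missing cross pairs once each. All later
  estimates weigh inner edges against missing pairs through this identity.\<close>

lemma pc_edge_balance:
  assumes "finite V"
  shows "pc R V V + pc (\<lambda>u v. c u \<noteq> c v \<and> \<not> R u v) V V
    = pc (\<lambda>u v. c u \<noteq> c v) V V + pc (\<lambda>u v. c u = c v \<and> R u v) V V"
proof -
  have "pc R V V = pc (\<lambda>u v. c u = c v \<and> R u v) V V + pc (\<lambda>u v. c u \<noteq> c v \<and> R u v) V V"
    using pc_split[of V V R "\<lambda>u v. c u = c v"] assms by (simp add: conj_commute)
  moreover have "pc (\<lambda>u v. c u \<noteq> c v) V V
      = pc (\<lambda>u v. c u \<noteq> c v \<and> R u v) V V + pc (\<lambda>u v. c u \<noteq> c v \<and> \<not> R u v) V V"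
    using pc_split[of V V "\<lambda>u v. c u \<noteq> c v" R] assms by simp
  ultimately show ?thesis by simp
qed

lemma card_doubleton_le: "card {x, y} \<le> 2"
  by (simp add: card_insert_if)

text \<open>\<open>S\<close> is the clique and \<open>T\<close> the set of pages. Vertex sets
  instead of an embedding make it easy to pass to a subset of \<open>A\<close> and to enlarge the
  clique.\<close>

definition has_book :: "('a \<Rightarrow> 'a \<Rightarrow> bool) \<Rightarrow> 'a set \<Rightarrow> nat \<Rightarrow> nat \<Rightarrow> bool" where
  "has_book R A p q \<longleftrightarrow> (\<exists>S T. S \<subseteq> A \<and> T \<subseteq> A \<and> finite S \<and> finite T \<and> card S = p \<and> card T = q \<and>
     S \<inter> T = {} \<and> (\<forall>x\<in>S. \<forall>y\<in>S \<union> T. x \<noteq> y \<longrightarrow> R x y))"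

text \<open>Induction on the clique size. With \<open>A'\<close> the neighbourhood of a vertex
  \<open>x\<close> of maximum degree and \<open>B\<close> the rest of \<open>A\<close>, the degrees
  in \<open>B\<close> sum to at most \<open>|A'| |B|\<close>, the number of cross edges gained by
  making \<open>B\<close> a new class. So the step loses nothing; the error stems from the base
  case, where all degrees are at most \<open>q\<close>.\<close>

lemma book_free_stability:
  assumes sym: "\<And>u v. R u v \<Longrightarrow> R v u" and irrefl: "\<And>v. \<not> R v v"
    and "finite A" "\<not> has_book R A (Suc m) q"
  shows "\<exists>c :: 'a \<Rightarrow> nat. (\<forall>v\<in>A. c v < Suc m) \<and>
    pc R A A + pc (\<lambda>u v. c u = c v \<and> R u v) A A \<le> pc (\<lambda>u v. c u \<noteq> c v) A A + 2 * q * card A"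
  using assms(3,4)
proof (induction m arbitrary: A)
  case 0
  have deg: "card {v \<in> A. R u v} \<le> q" if "u \<in> A" for u
  proof (rule ccontr)
    assume "\<not> card {v \<in> A. R u v} \<le> q"
    then obtain T where T: "T \<subseteq> {v \<in> A. R u v}" "card T = q" "finite T"
      by (meson nat_le_linear obtain_subset_with_card_n)
    then have "has_book R A (Suc 0) q" unfolding has_book_def using that irrefl
      by (intro exI[of _ "{u}"] exI[of _ T]) auto
    with 0 show False by simp
  qed
  have "pc R A A \<le> card A * q"
    unfolding pc_sum[OF 0(1) 0(1)] using deg sum_bounded_above[of A "\<lambda>u. card {v \<in> A. R u v}" q] by simp
  then have "2 * pc R A A \<le> 2 * q * card A" by (simp add: mult.commute)
  then show ?case by (intro exI[of _ "\<lambda>_. 0"]) (simp add: mult_2)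
next
  case (Suc m)
  show ?case
  proof (cases "A = {}")
    case True then show ?thesis by (simp add: pc_def)
  next
    case False
    define d where "d u = card {v \<in> A. R u v}" for u
    have "Max (d ` A) \<in> d ` A" using False Suc.prems by (intro Max_in) auto
    then obtain x where x: "x \<in> A" "Max (d ` A) = d x" by blast
    have max: "d u \<le> d x" if "u \<in> A" for u
      unfolding x(2)[symmetric] using that Suc.prems by (intro Max_ge) auto
    define A' where "A' = {v \<in> A. R x v}"
    define B where "B = A - A'"
    have fin: "finite A'" "finite B" and dis: "A' \<inter> B = {}" and un: "A = A' \<union> B"
      using Suc.prems by (auto simp: A'_def B_def)
    \<comment> \<open>Adding \<open>x\<close> to the clique of a book inside its neighbourhood would
      give a forbidden book in \<open>A\<close>.\<close>
    have "\<not> has_book R A' (Suc m) q"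
    proof
      assume "has_book R A' (Suc m) q"
      then obtain S T where ST: "S \<subseteq> A'" "T \<subseteq> A'" "finite S" "finite T" "card S = Suc m" "card T = q"
        "S \<inter> T = {}" "\<forall>x\<in>S. \<forall>y\<in>S \<union> T. x \<noteq> y \<longrightarrow> R x y"
        unfolding has_book_def by blast
      have "x \<notin> S" "x \<notin> T" using ST irrefl by (auto simp: A'_def)
      moreover have "\<forall>y\<in>S \<union> T. R x y \<and> R y x \<and> y \<in> A" using ST sym by (auto simp: A'_def)
      moreover from this have "\<forall>u\<in>insert x S. \<forall>v\<in>insert x S \<union> T. u \<noteq> v \<longrightarrow> R u v"
        using ST(8) by blast
      ultimately have "has_book R A (Suc (Suc m)) q" unfolding has_book_def using ST(3-7) x(1)
        by (intro exI[of _ "insert x S"] exI[of _ T] conjI) (simp_all add: subset_iff)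
      with Suc.prems show False by blast
    qed
    then obtain c where c: "\<forall>v\<in>A'. c v < Suc m"
      "pc R A' A' + pc (\<lambda>u v. c u = c v \<and> R u v) A' A' \<le> pc (\<lambda>u v. c u \<noteq> c v) A' A' + 2 * q * card A'"
      using Suc.IH fin by blast
    define c' where "c' v = (if v \<in> A' then c v else Suc m)" for v
    have c'B: "\<And>v. v \<in> B \<Longrightarrow> c' v = Suc m" using dis by (auto simp: c'_def)
    have c'A: "\<And>v. v \<in> A' \<Longrightarrow> c' v = c v" by (auto simp: c'_def)
    have less: "\<And>v. v \<in> A' \<Longrightarrow> c v \<noteq> Suc m" using c(1) by auto
    have 1: "pc R A A = pc R A' A' + 2 * pc R A' B + pc R B B"
      unfolding un by (rule pc_Un_self) (use fin dis sym in auto)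
    have "pc (\<lambda>u v. c' u = c' v \<and> R u v) A A = pc (\<lambda>u v. c' u = c' v \<and> R u v) A' A'
        + 2 * pc (\<lambda>u v. c' u = c' v \<and> R u v) A' B + pc (\<lambda>u v. c' u = c' v \<and> R u v) B B"
      unfolding un by (rule pc_Un_self) (use fin dis sym in auto)
    also have "pc (\<lambda>u v. c' u = c' v \<and> R u v) A' A' = pc (\<lambda>u v. c u = c v \<and> R u v) A' A'"
      by (rule pc_cong) (auto simp: c'A)
    also have "pc (\<lambda>u v. c' u = c' v \<and> R u v) B B = pc R B B"
      by (rule pc_cong) (auto simp: c'B)
    also have "pc (\<lambda>u v. c' u = c' v \<and> R u v) A' B = pc (\<lambda>_ _. False) A' B"
      by (rule pc_cong) (auto simp: c'B c'A less)
    finally have 2: "pc (\<lambda>u v. c' u = c' v \<and> R u v) A A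
        = pc (\<lambda>u v. c u = c v \<and> R u v) A' A' + pc R B B" by (simp add: pc_def)
    have "pc (\<lambda>u v. c' u \<noteq> c' v) A A = pc (\<lambda>u v. c' u \<noteq> c' v) A' A'
        + 2 * pc (\<lambda>u v. c' u \<noteq> c' v) A' B + pc (\<lambda>u v. c' u \<noteq> c' v) B B"
      unfolding un by (rule pc_Un_self) (use fin dis sym in auto)
    also have "pc (\<lambda>u v. c' u \<noteq> c' v) A' A' = pc (\<lambda>u v. c u \<noteq> c v) A' A'"
      by (rule pc_cong) (auto simp: c'A)
    also have "pc (\<lambda>u v. c' u \<noteq> c' v) B B = pc (\<lambda>_ _. False) B B"
      by (rule pc_cong) (auto simp: c'B)
    also have "pc (\<lambda>u v. c' u \<noteq> c' v) A' B = pc (\<lambda>_ _. True) A' B"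
      by (rule pc_cong) (auto simp: c'B c'A less)
    also have "pc (\<lambda>_ _. True) A' B = card A' * card B"
      using fin by (simp add: pc_sum)
    finally have 3: "pc (\<lambda>u v. c' u \<noteq> c' v) A A = pc (\<lambda>u v. c u \<noteq> c v) A' A' + 2 * (card A' * card B)"
      by (simp add: pc_def)
    \<comment> \<open>The degree sum over \<open>B\<close> counts the edges to \<open>A'\<close>
      once and those inside \<open>B\<close> twice; doubled, it is exactly what \<open>B\<close>
      adds to the left side of the claim.\<close>
    have "pc R B A = pc R B A' + pc R B B" unfolding un
      by (rule pc_Un_right) (use fin dis in auto)
    also have "pc R B A' = pc R A' B" using sym by (rule pc_commute)
    finally have "pc R A' B + pc R B B = pc R B A" by simp
    also have "\<dots> = (\<Sum>u\<in>B. d u)" using pc_sum[of B A R] fin Suc.prems by (simp add: d_def)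
    also have "\<dots> \<le> card B * card A'"
      using sum_bounded_above[of B d "d x"] max by (simp add: B_def d_def A'_def)
    finally have 4: "pc R A' B + pc R B B \<le> card A' * card B" by (simp add: mult.commute)
    have "card A' \<le> card A" using Suc.prems by (intro card_mono) (auto simp: A'_def)
    then have 5: "2 * q * card A' \<le> 2 * q * card A" by simp
    show ?thesis
    proof (intro exI[of _ c'] conjI)
      show "\<forall>v\<in>A. c' v < Suc (Suc m)" using c(1) by (auto simp: c'_def)
      show "pc R A A + pc (\<lambda>u v. c' u = c' v \<and> R u v) A A
          \<le> pc (\<lambda>u v. c' u \<noteq> c' v) A A + 2 * q * card A"
        using c(2) 1 2 3 4 5 by linarith
    qed
  qed
qed

section \<open>Coloured book-free graphs\<close>

locale coloured_book_free_graph =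
  fixes V :: "'a set" and R :: "'a \<Rightarrow> 'a \<Rightarrow> bool" and c :: "'a \<Rightarrow> nat" and p q :: nat
  assumes fin: "finite V"
    and sym: "R u v \<Longrightarrow> R v u" and irrefl: "\<not> R v v"
    and col: "v \<in> V \<Longrightarrow> c v < p"
    and no_book: "\<not> has_book R V p q"
    and q_pos: "0 < q"
begin

section \<open>Classes, missing pairs and inner pairs of a colouring\<close>

definition part :: "nat \<Rightarrow> 'a set" where
  "part i = {v \<in> V. c v = i}"

definition miss :: "'a \<Rightarrow> 'a set" where
  "miss v = {u \<in> V. c u \<noteq> c v \<and> \<not> R u v}"

definition nbs :: "'a set \<Rightarrow> nat \<Rightarrow> 'a set" where
  "nbs X i = {v \<in> V. c v = i \<and> (\<forall>x\<in>X. R x v)}"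

definition bad :: "nat \<Rightarrow> 'a set" where
  "bad g = {v \<in> V. g < card (miss v)}"

definition missing :: "('a \<times> 'a) set" where
  "missing = {(u, v). u \<in> V \<and> v \<in> V \<and> c u \<noteq> c v \<and> \<not> R u v}"

definition inner :: "('a \<times> 'a) set" where
  "inner = {(u, v). u \<in> V \<and> v \<in> V \<and> c u = c v \<and> R u v}"

lemma finite_sets [simp]:
  "finite (part i)" "finite (miss v)" "finite (nbs X i)" "finite (bad g)" "finite missing" "finite inner"
  using fin by (auto simp: part_def miss_def nbs_def bad_def missing_def inner_def intro: finite_pc)

lemma sym_iff: "R u v \<longleftrightarrow> R v u"
  using sym by blast

text \<open>Greedy extension: add to \<open>X\<close> a common neighbour from each class of
  \<open>C\<close> but one, where \<open>q\<close> common neighbours would be the pages of a book.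
  Each added vertex from \<open>\<Gamma>\<close> destroys at most \<open>g\<close> common neighbours
  in any other class, so some class must have had few from the start.\<close>

lemma small_common_nbs_good:
  assumes "\<Gamma> \<subseteq> V" "\<And>v. v \<in> \<Gamma> \<Longrightarrow> card (miss v) \<le> g"
    and "finite C" "C \<noteq> {}" "X \<subseteq> V" "\<forall>x\<in>X. \<forall>y\<in>X. x \<noteq> y \<longrightarrow> R x y" "card X + card C = Suc p"
  shows "\<exists>i\<in>C. card (nbs X i \<inter> \<Gamma>) < card C * g + q"
  using assms(3-)
proof (induction C arbitrary: X rule: finite_ne_induct)
  case (singleton i)
  have finX: "finite X" using fin singleton.prems finite_subset by blast
  show ?case
  proof (rule ccontr)
    assume "\<not> ?thesis"
    then have "q \<le> card (nbs X i \<inter> \<Gamma>)" by auto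
    then obtain T where T: "T \<subseteq> nbs X i \<inter> \<Gamma>" "card T = q" "finite T"
      by (meson obtain_subset_with_card_n)
    have "X \<inter> T = {}" using T irrefl by (auto simp: nbs_def)
    moreover have "\<forall>x\<in>X. \<forall>y\<in>X \<union> T. x \<noteq> y \<longrightarrow> R x y"
      using T singleton.prems by (auto simp: nbs_def)
    moreover have "T \<subseteq> V" using T by (auto simp: nbs_def)
    ultimately have "has_book R V p q" unfolding has_book_def
      using T singleton.prems finX by (intro exI[of _ X] exI[of _ T]) simp
    with no_book show False by simp
  qed
next
  case (insert i C)
  show ?case
  proof (cases "nbs X i \<inter> \<Gamma> = {}")
    case True
    then show ?thesis using q_pos by auto
  next
    case False
    then obtain v where v: "v \<in> nbs X i" "v \<in> \<Gamma>" by blast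
    have finX: "finite X" using fin insert.prems finite_subset by blast
    have "v \<notin> X" using v irrefl by (auto simp: nbs_def)
    then have "card (insert v X) + card C = Suc p" using finX insert by simp
    moreover have "insert v X \<subseteq> V" using v insert.prems by (auto simp: nbs_def)
    moreover have "\<forall>x\<in>insert v X. \<forall>y\<in>insert v X. x \<noteq> y \<longrightarrow> R x y"
      using v insert.prems sym by (auto simp: nbs_def)
    ultimately obtain j where j: "j \<in> C" "card (nbs (insert v X) j \<inter> \<Gamma>) < card C * g + q"
      using insert.IH by blast
    \<comment> \<open>\<open>miss v\<close> records only vertices outside the class of
      \<open>v\<close>, so \<open>j\<close> must be another class.\<close>
    have "j \<noteq> c v" using j insert v by (auto simp: nbs_def)
    then have "nbs X j \<inter> \<Gamma> \<subseteq> (nbs (insert v X) j \<inter> \<Gamma>) \<union> miss v"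
      using sym by (auto simp: nbs_def miss_def)
    then have "card (nbs X j \<inter> \<Gamma>) \<le> card ((nbs (insert v X) j \<inter> \<Gamma>) \<union> miss v)"
      by (intro card_mono) auto
    also have "\<dots> \<le> card (nbs (insert v X) j \<inter> \<Gamma>) + card (miss v)" by (rule card_Un_le)
    also have "\<dots> < card C * g + q + g" using j assms(2)[OF v(2)] by simp
    finally show ?thesis using insert j by (intro bexI[of _ j]) auto
  qed
qed

text \<open>The greedy choice avoids the bad vertices, which adds at most \<open>\<beta>\<close> to
  the bound. As \<open>X\<close> is nonempty, \<open>C\<close> has at most \<open>p\<close>
  classes.\<close>

lemma small_common_nbs:
  assumes "card (bad g) \<le> \<beta>" "finite C" "C \<noteq> {}" "X \<subseteq> V" "X \<noteq> {}"
    and "\<forall>x\<in>X. \<forall>y\<in>X. x \<noteq> y \<longrightarrow> R x y" "card X + card C = Suc p"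
  shows "\<exists>i\<in>C. card (nbs X i) < p * g + q + \<beta>"
proof -
  have "finite X" using assms fin finite_subset by blast
  then have "card X > 0" using assms by auto
  then have "card C \<le> p" using assms by linarith
  have good: "\<And>v. v \<in> V - bad g \<Longrightarrow> card (miss v) \<le> g" by (auto simp: bad_def)
  obtain i where i: "i \<in> C" "card (nbs X i \<inter> (V - bad g)) < card C * g + q"
    using small_common_nbs_good[OF Diff_subset good assms(2,3,4,6,7)] by blast
  have "nbs X i \<subseteq> (nbs X i \<inter> (V - bad g)) \<union> bad g" by (auto simp: nbs_def)
  then have "card (nbs X i) \<le> card ((nbs X i \<inter> (V - bad g)) \<union> bad g)"
    by (intro card_mono) auto
  also have "\<dots> \<le> card (nbs X i \<inter> (V - bad g)) + card (bad g)" by (rule card_Un_le)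
  also have "\<dots> < card C * g + q + \<beta>" using i assms by simp
  also have "\<dots> \<le> p * g + q + \<beta>" using \<open>card C \<le> p\<close> by simp
  finally show ?thesis using i by blast
qed

lemma small_common_nbs_inner_edge:
  assumes "card (bad g) \<le> \<beta>" "2 \<le> p" "(a, b) \<in> inner"
  shows "\<exists>i<p. i \<noteq> c a \<and> card (nbs {a, b} i) < p * g + q + \<beta>"
proof -
  have ab: "a \<in> V" "b \<in> V" "R a b" "c a < p" "a \<noteq> b"
    using assms col irrefl by (auto simp: inner_def)
  have "card ({..<p} - {c a}) = p - 1" using ab by simp
  then have "{..<p} - {c a} \<noteq> {}" using assms by (metis One_nat_def Suc_le_eq card.empty diff_is_0_eq not_less numeral_2_eq_2)
  then have "\<exists>i\<in>{..<p} - {c a}. card (nbs {a, b} i) < p * g + q + \<beta>"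
    using ab assms sym by (intro small_common_nbs) auto
  then show ?thesis by blast
qed

text \<open>The clique is a triangle on an inner edge and a vertex of another class. The other
  \<open>p - 2\<close> classes serve as \<open>C\<close>, which is nonempty because
  \<open>p \<ge> 3\<close>.\<close>

lemma small_common_nbs_triangle:
  assumes "card (bad g) \<le> \<beta>" "3 \<le> p" "(a, b) \<in> inner" "d \<in> V" "c d \<noteq> c a" "R a d" "R b d"
  shows "\<exists>i<p. i \<noteq> c a \<and> i \<noteq> c d \<and> card (nbs {a, b, d} i) < p * g + q + \<beta>"
proof -
  have ab: "a \<in> V" "b \<in> V" "R a b" "c a < p" "c d < p" "a \<noteq> b" "a \<noteq> d" "b \<noteq> d"
    using assms col irrefl by (auto simp: inner_def)
  have card: "card ({..<p} - {c a, c d}) = p - 2" using ab assms by (simp add: card_Diff_subset)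
  then have "{..<p} - {c a, c d} \<noteq> {}" using assms
    by (metis card.empty diff_is_0_eq not_less_eq_eq numeral_2_eq_2 numeral_3_eq_3)
  then have "\<exists>i\<in>{..<p} - {c a, c d}. card (nbs {a, b, d} i) < p * g + q + \<beta>"
    using ab assms sym card by (intro small_common_nbs) auto
  then show ?thesis by blast
qed

lemma card_part_le:
  assumes "i \<noteq> c a" "i \<noteq> c b"
  shows "card (part i) \<le> card (nbs {a, b} i) + card (miss a) + card (miss b)"
proof -
  have "part i \<subseteq> (nbs {a, b} i \<union> miss a) \<union> miss b"
    using assms sym by (auto simp: part_def nbs_def miss_def)
  then have "card (part i) \<le> card ((nbs {a, b} i \<union> miss a) \<union> miss b)"
    by (intro card_mono) auto
  then show ?thesis
    using card_Un_le[of "nbs {a, b} i \<union> miss a" "miss b"] card_Un_le[of "nbs {a, b} i" "miss a"]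
    by linarith
qed

lemma card_nbs_drop:
  assumes "i \<noteq> c x"
  shows "card (nbs X i) \<le> card (nbs (insert x X) i) + card (miss x)"
proof -
  have "nbs X i \<subseteq> nbs (insert x X) i \<union> miss x"
    using assms sym by (auto simp: nbs_def miss_def)
  then have "card (nbs X i) \<le> card (nbs (insert x X) i \<union> miss x)"
    by (intro card_mono) auto
  then show ?thesis using card_Un_le[of "nbs (insert x X) i" "miss x"] by linarith
qed

text \<open>Two good ends would share almost all of every other class, so no class could have few
  common neighbours.\<close>

lemma inner_edge_meets_bad:
  assumes "card (bad g) \<le> \<beta>" "2 \<le> p" "(a, b) \<in> inner"
    and "\<And>i. i < p \<Longrightarrow> m \<le> card (part i)" "p * g + q + \<beta> + 2 * g \<le> m"
  shows "a \<in> bad g \<or> b \<in> bad g"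
proof (rule ccontr)
  assume "\<not> ?thesis"
  then have good: "card (miss a) \<le> g" "card (miss b) \<le> g"
    using assms by (auto simp: bad_def inner_def)
  obtain i where i: "i < p" "i \<noteq> c a" "card (nbs {a, b} i) < p * g + q + \<beta>"
    using small_common_nbs_inner_edge[OF assms(1-3)] by blast
  have "c a = c b" using assms by (auto simp: inner_def)
  then have "card (part i) \<le> card (nbs {a, b} i) + card (miss a) + card (miss b)"
    using i by (intro card_part_le) auto
  with i good assms(4)[OF i(1)] assms(5) show False by linarith
qed

section \<open>Lower bounds for the number of missing pairs\<close>

text \<open>\<open>missing\<close> is symmetric and \<open>P\<close> contains at most one
  orientation of each pair, so \<open>P\<close> and its converse are disjoint subsets of it.\<close>

lemma disjoint_pairs_le_missing:
  assumes "P \<subseteq> missing" "P \<inter> P\<inverse> = {}"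
  shows "2 * card P \<le> card missing"
proof -
  have "P\<inverse> \<subseteq> missing" using assms sym by (auto simp: missing_def)
  then have "card (P \<union> P\<inverse>) \<le> card missing" using assms by (intro card_mono) auto
  moreover have "finite P" using assms(1) by (rule finite_subset) simp
  then have "card (P \<union> P\<inverse>) = card P + card (P\<inverse>)" using assms by (intro card_Un_disjoint) auto
  ultimately show ?thesis by simp
qed

text \<open>Each vertex of \<open>Q\<close> is missed by \<open>a\<close> or by \<open>b\<close>,
  which yields one missing pair per vertex; the pairs in \<open>P\<close> avoid \<open>a\<close> and
  \<open>b\<close> and come on top. The case \<open>a = b\<close> is allowed and serves for the star
  of inner edges at one vertex.\<close>

lemma noncommon_le_missing:
  assumes "a \<in> V" "b \<in> V" "Q \<subseteq> V"
    and Q: "\<And>v. v \<in> Q \<Longrightarrow> c v \<noteq> c a \<and> c v \<noteq> c b \<and> \<not> (R a v \<and> R b v)"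
    and "P \<subseteq> missing" "P \<inter> P\<inverse> = {}" and P: "\<And>u v. (u, v) \<in> P \<Longrightarrow> u \<notin> {a, b} \<and> v \<notin> {a, b}"
  shows "2 * (card Q + card P) \<le> card missing"
proof -
  define f where "f v = (if R a v then b else a, v)" for v
  have inj: "inj_on f Q" by (auto simp: f_def inj_on_def)
  have "finite P" using assms(5) by (rule finite_subset) simp
  moreover have "finite Q" using assms(3) fin by (rule finite_subset)
  moreover define F where "F = f ` Q"
  have F: "(u = a \<or> u = b) \<and> v \<in> Q" if "(u, v) \<in> F" for u v
    using that by (auto simp: F_def f_def)
  have PQ: "F \<inter> P = {}" "F \<inter> P\<inverse> = {}" "F\<inverse> \<inter> P = {}"
    using P by (auto dest!: F)
  ultimately have "card (f ` Q \<union> P) = card Q + card P"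
    using inj PQ by (simp add: card_Un_disjoint card_image F_def)
  moreover have "2 * card (f ` Q \<union> P) \<le> card missing"
  proof (rule disjoint_pairs_le_missing)
    have "f v \<in> missing" if "v \<in> Q" for v
      using Q[OF that] that assms(1-3) by (auto simp: f_def missing_def)
    then show "f ` Q \<union> P \<subseteq> missing" using assms(5) by blast
    have "F \<inter> F\<inverse> = {}" using Q by (auto dest!: F)
    then show "(f ` Q \<union> P) \<inter> (f ` Q \<union> P)\<inverse> = {}" 
      unfolding F_def[symmetric] converse_Un using PQ assms(6) by blast
  qed
  ultimately show ?thesis by simp
qed

lemma card_missing: "card missing = (\<Sum>v\<in>V. card (miss v))"
proof -
  have "card missing = (\<Sum>v\<in>V. card {u \<in> V. c v \<noteq> c u \<and> \<not> R v u})"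
    using pc_sum[of V V "\<lambda>u v. c u \<noteq> c v \<and> \<not> R u v"] fin by (simp add: pc_def missing_def)
  then show ?thesis using sym_iff by (auto simp: miss_def intro!: sum.cong arg_cong[where f = card])
qed

text \<open>Markov's inequality for the number of missing pairs at a vertex.\<close>

lemma card_bad_le: "card (bad g) * Suc g \<le> card missing"
proof -
  have "card (bad g) * Suc g = (\<Sum>v\<in>bad g. Suc g)" by simp
  also have "\<dots> \<le> (\<Sum>v\<in>bad g. card (miss v))"
    by (rule sum_mono) (auto simp: bad_def)
  also have "\<dots> \<le> (\<Sum>v\<in>V. card (miss v))"
    using fin by (intro sum_mono2) (auto simp: bad_def)
  finally show ?thesis by (simp add: card_missing)
qed

lemma part_le_missing:
  assumes "a \<in> V" "b \<in> V" "c b = c a" "i \<noteq> c a"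
    and "P \<subseteq> missing" "P \<inter> P\<inverse> = {}" "\<And>u v. (u, v) \<in> P \<Longrightarrow> u \<notin> {a, b} \<and> v \<notin> {a, b}"
  shows "2 * (card (part i) + card P) \<le> card missing + 2 * card (nbs {a, b} i)"
proof -
  have "2 * (card (part i - nbs {a, b} i) + card P) \<le> card missing"
    by (rule noncommon_le_missing[of a b]) (use assms in \<open>auto simp: part_def nbs_def\<close>)
  moreover have "card (part i) \<le> card (part i - nbs {a, b} i) + card (nbs {a, b} i)"
    using diff_card_le_card_Diff[of "nbs {a, b} i" "part i"] by simp
  ultimately show ?thesis by simp
qed

lemma two_parts_le_missing:
  assumes "a \<in> V" "b \<in> V" "c b = c a" "i \<noteq> c a" "j \<noteq> c a" "i \<noteq> j"
  shows "2 * (card (part i) + card (part j))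
    \<le> card missing + 2 * (card (nbs {a, b} i) + card (nbs {a, b} j))"
proof -
  let ?N = "nbs {a, b} i \<union> nbs {a, b} j"
  have "2 * (card (part i \<union> part j - ?N) + card ({} :: ('a \<times> 'a) set)) \<le> card missing"
    by (rule noncommon_le_missing[of a b]) (use assms in \<open>auto simp: part_def nbs_def\<close>)
  moreover have "card (part i \<union> part j) \<le> card (part i \<union> part j - ?N) + card ?N"
    using diff_card_le_card_Diff[of ?N "part i \<union> part j"] by simp
  moreover have "card (part i \<union> part j) = card (part i) + card (part j)"
    using assms by (intro card_Un_disjoint finite_sets) (auto simp: part_def)
  moreover have "card ?N \<le> card (nbs {a, b} i) + card (nbs {a, b} j)" by (rule card_Un_le)
  ultimately show ?thesis by simp
qed

text \<open>The inner edge alone accounts for almost a whole class of missing pairs, and those at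
  \<open>v\<close> are added to them. The summand 4 pays for pairs from \<open>v\<close> to
  \<open>a\<close> or \<open>b\<close>, which may have been counted already.\<close>

lemma miss_le_of_inner_edge:
  assumes "card (bad g) \<le> \<beta>" "2 \<le> p" "(a, b) \<in> inner" "v \<in> V" "v \<notin> {a, b}"
    and "\<And>i. i < p \<Longrightarrow> m \<le> card (part i)"
  shows "2 * (m + card (miss v)) \<le> card missing + 2 * (p * g + q + \<beta>) + 4"
proof -
  obtain i where i: "i < p" "i \<noteq> c a" "card (nbs {a, b} i) < p * g + q + \<beta>"
    using small_common_nbs_inner_edge[OF assms(1-3)] by blast
  let ?P = "{v} \<times> (miss v - {a, b})"
  have "2 * (card (part i) + card ?P) \<le> card missing + 2 * card (nbs {a, b} i)"
    by (rule part_le_missing)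
      (use assms i sym in \<open>auto simp: inner_def missing_def miss_def\<close>)
  moreover have "card (miss v) - card {a, b} \<le> card (miss v - {a, b})"
    by (rule diff_card_le_card_Diff) simp
  moreover have "card {a, b} \<le> 2" by (rule card_doubleton_le)
  ultimately show ?thesis using assms(6)[OF i(1)] i by (simp add: card_cartesian_product)
qed

end

text \<open>Local optimality: in a colouring with the fewest inner edges, moving \<open>w\<close> to
  class \<open>j\<close> cannot pay off.\<close>

locale optimally_coloured_graph = coloured_book_free_graph +
  assumes opt: "w \<in> V \<Longrightarrow> j < p \<Longrightarrow> card (nbs {w} (c w)) \<le> card (nbs {w} j)"
begin

text \<open>With \<open>X = {w}\<close> and all \<open>p\<close> classes in \<open>C\<close>, some
  class contains few neighbours of \<open>w\<close>; by \<open>opt\<close> its own class contains no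
  more.\<close>

lemma own_degree_less:
  assumes "card (bad g) \<le> \<beta>" "w \<in> V"
  shows "card (nbs {w} (c w)) < p * g + q + \<beta>"
proof -
  have "p > 0" using col assms by fastforce
  then have "{..<p} \<noteq> {}" by auto
  then have "\<exists>i\<in>{..<p}. card (nbs {w} i) < p * g + q + \<beta>"
    using assms by (intro small_common_nbs) auto
  then show ?thesis using opt[OF assms(2)] by (meson lessThan_iff order_le_less_trans)
qed

text \<open>Every inner edge joins two bad vertices or has one end in \<open>W\<close> and the other
  good. A vertex of \<open>W\<close> has fewer than \<open>L\<close> inner neighbours but misses
  almost a class, so three of them would exceed the budget of about \<open>2 * k\<close> missing
  pairs. Hence \<open>card W \<le> 2\<close>.\<close>

lemma card_inner_le:
  fixes g \<beta> :: nat
  defines "L \<equiv> p * g + q + \<beta>"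
  assumes bad: "card (bad g) \<le> \<beta>" and "2 \<le> p"
    and m: "\<And>i. i < p \<Longrightarrow> m \<le> card (part i)" "L + 2 * g \<le> m"
    and "card missing \<le> card inner + 2 * k" "2 * k + \<beta> * \<beta> + 3 * g + 9 * L < 3 * m"
  shows "card inner \<le> \<beta> * \<beta> + 4 * L"
proof -
  define W where "W = {w \<in> bad g. \<exists>b. b \<notin> bad g \<and> (w, b) \<in> inner}"
  have finW: "finite W" by (simp add: W_def)
  let ?S = "SIGMA w:W. nbs {w} (c w)"
  have "inner \<subseteq> (bad g \<times> bad g \<union> ?S) \<union> ?S\<inverse>"
  proof (rule subrelI)
    fix a b assume ab: "(a, b) \<in> inner"
    then have "(b, a) \<in> inner" using sym by (auto simp: inner_def)
    moreover have "a \<in> bad g \<or> b \<in> bad g"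
      using inner_edge_meets_bad[OF bad \<open>2 \<le> p\<close> ab m(1)] m(2) by (simp add: L_def)
    ultimately show "(a, b) \<in> (bad g \<times> bad g \<union> ?S) \<union> ?S\<inverse>"
      using ab by (auto simp: W_def inner_def nbs_def)
  qed
  then have "card inner \<le> card ((bad g \<times> bad g \<union> ?S) \<union> ?S\<inverse>)"
    using finW by (intro card_mono) auto
  also have "\<dots> \<le> card (bad g) * card (bad g) + card ?S + card ?S"
    using card_Un_le[of "bad g \<times> bad g \<union> ?S" "?S\<inverse>"] card_Un_le[of "bad g \<times> bad g" ?S]
    by (simp add: card_cartesian_product)
  also have "card ?S = (\<Sum>w\<in>W. card (nbs {w} (c w)))" using finW by simp
  also have "\<dots> \<le> card W * L"
    using sum_bounded_above[of W "\<lambda>w. card (nbs {w} (c w))" L] own_degree_less[OF bad]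
    by (auto simp: W_def bad_def L_def intro: less_imp_le)
  finally have inner: "card inner \<le> \<beta> * \<beta> + 2 * (card W * L)"
    using mult_le_mono[OF bad bad] by linarith
  have big: "m - L - g \<le> card (miss w)" if w: "w \<in> W" for w
  proof -
    from w obtain b where b: "b \<notin> bad g" "(w, b) \<in> inner" by (auto simp: W_def)
    obtain i where i: "i < p" "i \<noteq> c w" "card (nbs {w, b} i) < p * g + q + \<beta>"
      using small_common_nbs_inner_edge[OF bad \<open>2 \<le> p\<close> b(2)] by blast
    have "card (part i) \<le> card (nbs {w, b} i) + card (miss w) + card (miss b)"
      using i b by (intro card_part_le) (auto simp: inner_def)
    moreover have "card (miss b) \<le> g" using b by (auto simp: bad_def inner_def)
    ultimately show ?thesis using m(1)[OF i(1)] i by (simp add: L_def)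
  qed
  have "card W * (m - L - g) \<le> (\<Sum>w\<in>W. card (miss w))"
    using sum_bounded_below[of W "m - L - g"] big by simp
  also have "\<dots> \<le> card missing" unfolding card_missing using fin
    by (intro sum_mono2) (auto simp: W_def bad_def)
  finally have W: "card W * (m - L - g) \<le> \<beta> * \<beta> + 2 * (card W * L) + 2 * k"
    using inner assms(6) by linarith
  \<comment> \<open>The substitution removes truncated subtraction and lets
    \<open>2 * (card W * L)\<close> cancel.\<close>
  have "\<exists>r. m = 3 * L + g + r" using assms(7) by (intro le_Suc_ex) linarith
  then obtain r where r: "m = 3 * L + g + r" ..
  have "card W * (2 * L + r) \<le> \<beta> * \<beta> + 2 * (card W * L) + 2 * k"
    using W r by simp
  then have "card W * r \<le> \<beta> * \<beta> + 2 * k" by (simp add: algebra_simps)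
  also have "\<dots> < 3 * r" using assms(7) r by simp
  finally have "card W \<le> 2" by simp
  then have "card W * L \<le> 2 * L" by (rule mult_le_mono1)
  then show ?thesis using inner by linarith
qed

text \<open>By \<open>good\<close>, the bad vertices lie on every inner edge. So there is a single
  inner edge, or all inner edges form a star at the only bad vertex. Either way the balance identity
  turns the conclusion into the bound \<open>e(G) \<le> e(K) - |V_i| + 1\<close>.\<close>

lemma missing_ge_part:
  fixes g :: nat
  defines "L \<equiv> p * g + q + 2"
  assumes "3 \<le> p" and ab: "(a, b) \<in> inner"
    and good: "\<And>a b v. (a, b) \<in> inner \<Longrightarrow> v \<in> V \<Longrightarrow> v \<notin> {a, b} \<Longrightarrow> card (miss v) \<le> g"
    and m: "\<And>i. i < p \<Longrightarrow> m \<le> card (part i)" "L + 2 * g \<le> m"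
    and M: "card missing + 4 * L + 6 * g < 4 * m"
  shows "\<exists>i<p. 2 * card (part i) + card inner \<le> card missing + 2"
proof -
  have p2: "2 \<le> p" using assms by simp
  have bad_sub: "bad g \<subseteq> {a, b}" if "(a, b) \<in> inner" for a b
    using good[OF that] by (force simp: bad_def)
  have "card (bad g) \<le> card {a, b}" using bad_sub[OF ab] by (intro card_mono) auto
  also have "\<dots> \<le> 2" by (rule card_doubleton_le)
  finally have bad: "card (bad g) \<le> 2" .
  \<comment> \<open>Few common neighbours in two classes would force about \<open>4 * m\<close>
    ordered missing pairs, more than \<open>M\<close> permits. The case \<open>u = v\<close> is
    included.\<close>
  have no_two: False if "u \<in> V" "v \<in> V" "c v = c u" "i < p" "i \<noteq> c u" "j < p" "j \<noteq> c u" "i \<noteq> j"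
      "card (nbs {u, v} i) + card (nbs {u, v} j) \<le> 2 * L + 3 * g" for u v i j
    using two_parts_le_missing[OF that(1,2,3,5,7,8)] that(9) m(1)[OF that(4)] m(1)[OF that(6)] M
    by simp
  show ?thesis
  proof (cases "inner \<subseteq> {(a, b), (b, a)}")
    case True
    have "card inner \<le> card {(a, b), (b, a)}" using True by (intro card_mono) auto
    also have "\<dots> \<le> 2" by (rule card_doubleton_le)
    finally have inner: "card inner \<le> 2" .
    have V: "a \<in> V" "b \<in> V" "c b = c a" using ab by (auto simp: inner_def)
    obtain i where i: "i < p" "i \<noteq> c a" "card (nbs {a, b} i) < L"
      using small_common_nbs_inner_edge[OF bad p2 ab] unfolding L_def by blast
    \<comment> \<open>A common neighbour \<open>d\<close> in class \<open>i\<close> would complete a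
      triangle with few common neighbours in a further class \<open>j\<close>. As \<open>d\<close>
      is good, \<open>a\<close> and \<open>b\<close> then have few there too, against
      \<open>no_two\<close>.\<close>
    have "nbs {a, b} i = {}"
    proof (rule ccontr)
      assume "nbs {a, b} i \<noteq> {}"
      then obtain d where d: "d \<in> V" "c d = i" "R a d" "R b d" by (auto simp: nbs_def)
      have "d \<notin> {a, b}" using d irrefl by auto
      then have gd: "card (miss d) \<le> g" using good[OF ab] d by blast
      obtain j where j: "j < p" "j \<noteq> c a" "j \<noteq> i" "card (nbs {a, b, d} j) < L"
        using small_common_nbs_triangle[OF bad \<open>3 \<le> p\<close> ab] d i unfolding L_def by blast
      have "insert d {a, b} = {a, b, d}" by auto
      then have "card (nbs {a, b} j) < L + g"
        using card_nbs_drop[of j d "{a, b}"] gd j d by auto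
      then show False using no_two[of a b i j] V i j by simp
    qed
    then show ?thesis
      using part_le_missing[of a b i "{}"] V i inner by (intro exI[of _ i]) auto
  next
    case False
    then obtain x y where xy: "(x, y) \<in> inner" "(x, y) \<noteq> (a, b)" "(x, y) \<noteq> (b, a)" by auto
    have meets: "u \<in> bad g \<or> v \<in> bad g" if "(u, v) \<in> inner" for u v
      using inner_edge_meets_bad[OF bad p2 that m(1)] m(2) by (simp add: L_def)
    have ne: "a \<noteq> b" "x \<noteq> y" using ab xy irrefl by (auto simp: inner_def)
    from meets[OF ab] obtain w where w: "w \<in> bad g" by blast
    \<comment> \<open>Two distinct inner edges share at most one vertex, and \<open>bad g\<close> is
      nonempty and contained in both.\<close>
    have only: "bad g = {w}"
      using bad_sub[OF ab] bad_sub[OF xy(1)] xy(2,3) ne w by auto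
    have "\<exists>b. (w, b) \<in> inner"
      using meets[OF ab] ab only sym by (auto simp: inner_def)
    then obtain b where wb: "(w, b) \<in> inner" ..
    then have V: "w \<in> V" "b \<in> V" "c b = c w" "b \<noteq> w" using irrefl by (auto simp: inner_def)
    have gw: "card (miss v) \<le> g" if "v \<in> V" "v \<noteq> w" for v
    proof -
      have "v \<notin> bad g" using only that by simp
      then show ?thesis using that by (simp add: bad_def)
    qed
    let ?N = "nbs {w} (c w)"
    have "inner \<subseteq> {w} \<times> ?N \<union> ?N \<times> {w}"
    proof (rule subrelI)
      fix u v assume uv: "(u, v) \<in> inner"
      have "u = w \<or> v = w" using meets[OF uv] only by blast
      then show "(u, v) \<in> {w} \<times> ?N \<union> ?N \<times> {w}"
        using uv sym by (auto simp: inner_def nbs_def)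
    qed
    then have "card inner \<le> card ({w} \<times> ?N \<union> ?N \<times> {w})" by (intro card_mono) auto
    also have "\<dots> \<le> 2 * card ?N"
      using card_Un_le[of "{w} \<times> ?N" "?N \<times> {w}"] by (simp add: card_cartesian_product)
    finally have inner: "card inner \<le> 2 * card ?N" .
    obtain i where i: "i < p" "i \<noteq> c w" "card (nbs {w, b} i) < L"
      using small_common_nbs_inner_edge[OF bad p2 wb] unfolding L_def by blast
    have drop: "card (nbs {w} j) \<le> card (nbs {w, b} j) + g"
      if "b \<in> V" "c b = c w" "b \<noteq> w" "j \<noteq> c w" for b j
      using card_nbs_drop[of j b "{w}"] gw[of b] that by (simp add: insert_commute)
    have Ni: "card (nbs {w} i) < L + g" using drop[of b i] V i by simp
    \<comment> \<open>The triangle on \<open>w\<close>, \<open>b'\<close> and \<open>d\<close> would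
      leave \<open>w\<close> with few neighbours in a second class besides \<open>i\<close>.\<close>
    have no_edge: "\<not> R b' d" if "b' \<in> ?N" "d \<in> nbs {w} i" for b' d
    proof
      assume R: "R b' d"
      have b': "(w, b') \<in> inner" "b' \<in> V" "c b' = c w" "b' \<noteq> w"
        using that V irrefl by (auto simp: nbs_def inner_def)
      have d: "d \<in> V" "c d = i" "R w d" "d \<noteq> w" using that irrefl by (auto simp: nbs_def)
      obtain j where j: "j < p" "j \<noteq> c w" "j \<noteq> i" "card (nbs {w, b', d} j) < L"
        using small_common_nbs_triangle[OF bad \<open>3 \<le> p\<close> b'(1)] d i R unfolding L_def by blast
      have "insert d {w, b'} = {w, b', d}" by auto
      then have "card (nbs {w, b'} j) < L + g"
        using card_nbs_drop[of j d "{w, b'}"] gw[of d] j d by auto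
      then have "card (nbs {w} j) < L + 2 * g" using drop[of b' j] b' j by simp
      then show False using no_two[of w w i j] V i j Ni by simp
    qed
    \<comment> \<open>Here \<open>a = b = w\<close>: the non-neighbours of \<open>w\<close> in class
      \<open>i\<close> are counted together with the pairs between its two neighbourhoods.\<close>
    have "2 * (card (part i) + card (?N \<times> nbs {w} i)) \<le> card missing + 2 * card (nbs {w, w} i)"
    proof (rule part_le_missing)
      show "?N \<times> nbs {w} i \<subseteq> missing" using no_edge i by (auto simp: missing_def nbs_def)
      show "(?N \<times> nbs {w} i) \<inter> (?N \<times> nbs {w} i)\<inverse> = {}" using i by (auto simp: nbs_def)
    qed (use V i irrefl in \<open>auto simp: nbs_def\<close>)
    then have 1: "2 * card (part i) + 2 * (card ?N * card (nbs {w} i))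
        \<le> card missing + 2 * card (nbs {w} i)"
      by (simp add: card_cartesian_product)
    have "b \<in> ?N" using wb by (auto simp: nbs_def inner_def)
    then have "0 < card ?N" by (auto simp: card_gt_0_iff)
    moreover have "card ?N \<le> card (nbs {w} i)" using opt V i by simp
    ultimately obtain s t where st: "card ?N = Suc s" "card (nbs {w} i) = Suc t"
      by (metis Suc_le_D gr0_implies_Suc)
    \<comment> \<open>This is \<open>(d - 1) * (d_i - 1) \<ge> 0\<close> for the two neighbourhood
      sizes; \<open>d_i\<close> is positive because \<open>opt\<close> gives
      \<open>d \<le> d_i\<close>.\<close>
    then have "card ?N + card (nbs {w} i) \<le> card ?N * card (nbs {w} i) + 1" by simp
    then show ?thesis using 1 inner i by (intro exI[of _ i]) linarith
  qed
qed

end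

section \<open>The upper bound\<close>

text \<open>Splits off the inner edges at \<open>w\<close>, the only term that changes when
  \<open>w\<close> is recoloured.\<close>

lemma pc_inner_remove:
  assumes "finite V" "w \<in> V" and sym: "\<And>u v. R u v \<Longrightarrow> R v u" and irrefl: "\<And>v. \<not> R v v"
  shows "pc (\<lambda>u v. c u = c v \<and> R u v) V V
    = pc (\<lambda>u v. c u = c v \<and> R u v) (V - {w}) (V - {w}) + 2 * card {v \<in> V. c v = c w \<and> R w v}"
proof -
  let ?P = "\<lambda>u v. c u = c v \<and> R u v"
  have "pc ?P ({w} \<union> (V - {w})) ({w} \<union> (V - {w}))
      = pc ?P {w} {w} + 2 * pc ?P {w} (V - {w}) + pc ?P (V - {w}) (V - {w})"
    by (rule pc_Un_self) (use assms in auto)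
  moreover have "{w} \<union> (V - {w}) = V" using assms by auto
  moreover have "pc ?P {w} {w} = 0" using irrefl by (simp add: pc_sum)
  moreover have "{v \<in> V - {w}. c w = c v \<and> R w v} = {v \<in> V. c v = c w \<and> R w v}"
    using irrefl by auto
  then have "pc ?P {w} (V - {w}) = card {v \<in> V. c v = c w \<and> R w v}"
    using assms by (simp add: pc_sum)
  ultimately show ?thesis by simp
qed

lemma sum_card_colour_classes:
  assumes "finite V" "\<And>v. v \<in> V \<Longrightarrow> c v < (p :: nat)"
  shows "(\<Sum>i<p. card {v \<in> V. c v = i}) = card V"
proof -
  have "card (\<Union>i\<in>{..<p}. {v \<in> V. c v = i}) = (\<Sum>i<p. card {v \<in> V. c v = i})"
    using assms by (intro card_UN_disjoint) auto
  moreover have "(\<Union>i\<in>{..<p}. {v \<in> V. c v = i}) = V" using assms(2) by auto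
  ultimately show ?thesis by simp
qed

lemma pc_multipartite:
  assumes "finite V" "\<And>v. v \<in> V \<Longrightarrow> c v < (p :: nat)"
  shows "pc (\<lambda>u v. c u \<noteq> c v) V V + (\<Sum>i<p. card {v \<in> V. c v = i} ^ 2) = card V ^ 2"
proof -
  have "{(u, v). u \<in> V \<and> v \<in> V \<and> c u = c v} = (\<Union>i\<in>{..<p}. {v \<in> V. c v = i} \<times> {v \<in> V. c v = i})"
    using assms(2) by auto
  then have "pc (\<lambda>u v. c u = c v) V V = card (\<Union>i\<in>{..<p}. {v \<in> V. c v = i} \<times> {v \<in> V. c v = i})"
    by (simp add: pc_def)
  also have "\<dots> = (\<Sum>i<p. card ({v \<in> V. c v = i} \<times> {v \<in> V. c v = i}))"
    using assms(1) by (intro card_UN_disjoint) auto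
  finally have "pc (\<lambda>u v. c u = c v) V V = (\<Sum>i<p. card {v \<in> V. c v = i} ^ 2)"
    by (simp add: card_cartesian_product power2_eq_square)
  moreover have "pc (\<lambda>_ _. True) V V = card V ^ 2"
    using assms(1) by (simp add: pc_sum power2_eq_square)
  ultimately show ?thesis
    using pc_split[of V V "\<lambda>_ _. True" "\<lambda>u v. c u = c v"] assms(1) by simp
qed

text \<open>Twice the number of edges of \<open>T_{n,p}\<close>. The closed form comes from \<open>a\<^sup>2 \<ge> (2 k + 1) a - k (k + 1)\<close>,
  with equality exactly for the part sizes \<open>a = k\<close> and \<open>a = k + 1\<close>.\<close>

definition turan2 :: "nat \<Rightarrow> nat \<Rightarrow> int" where
  "turan2 n p = (let k = int (n div p) in int n ^ 2 - (2 * k + 1) * int n + int p * k * (k + 1))"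

text \<open>The subtracted sum measures imbalance: its terms are products of consecutive integers,
  hence nonnegative. It gives the Turan bound, lower bounds on class sizes, and the exact count for
  a balanced colouring.\<close>

lemma pc_multipartite_turan2:
  fixes k :: int
  assumes "finite V" "\<And>v. v \<in> V \<Longrightarrow> c v < (p :: nat)"
  defines "k \<equiv> int (card V div p)"
  shows "int (pc (\<lambda>u v. c u \<noteq> c v) V V) = turan2 (card V) p
    - (\<Sum>i<p. (int (card {v \<in> V. c v = i}) - k) * (int (card {v \<in> V. c v = i}) - k - 1))"
proof -
  let ?a = "\<lambda>i. int (card {v \<in> V. c v = i})"
  have "(\<Sum>i<p. (?a i - k) * (?a i - k - 1)) = (\<Sum>i<p. ?a i ^ 2 - (2 * k + 1) * ?a i + k * (k + 1))"
    by (rule sum.cong) (auto simp: algebra_simps power2_eq_square)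
  also have "\<dots> = (\<Sum>i<p. ?a i ^ 2) - (2 * k + 1) * (\<Sum>i<p. ?a i) + int p * k * (k + 1)"
    by (simp add: sum.distrib sum_subtractf sum_distrib_left)
  also have "(\<Sum>i<p. ?a i) = int (card V)"
    using sum_card_colour_classes[of V c p] assms(1,2) by (metis of_nat_sum)
  also have "(\<Sum>i<p. ?a i ^ 2) = int (card V) ^ 2 - int (pc (\<lambda>u v. c u \<noteq> c v) V V)"
  proof -
    have "int (pc (\<lambda>u v. c u \<noteq> c v) V V) + (\<Sum>i<p. ?a i ^ 2) = int (card V) ^ 2"
      using arg_cong[OF pc_multipartite[of V c p, OF assms(1,2)], of int] by simp
    then show ?thesis by simp
  qed
  finally show ?thesis by (simp add: turan2_def Let_def k_def)
qed

lemma consecutive_prod_nonneg: "0 \<le> (x :: int) * (x - 1)"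
  by (cases "x \<le> 0") (auto simp: mult_nonpos_nonpos)

lemma consecutive_sum_ge:
  fixes a :: "nat \<Rightarrow> int"
  assumes "i < p"
  shows "(a i - k) * (a i - k - 1) \<le> (\<Sum>j<p. (a j - k) * (a j - k - 1))"
proof -
  have "(\<Sum>j\<in>{i}. (a j - k) * (a j - k - 1)) \<le> (\<Sum>j<p. (a j - k) * (a j - k - 1))"
    using assms consecutive_prod_nonneg by (intro sum_mono2) auto
  then show ?thesis by simp
qed

text \<open>By contradiction, in rounds. Stability makes the number of missing pairs linear in
  \<open>n\<close>, so at most \<open>\<beta>\<close> vertices are bad and each class has at least
  \<open>k - g\<close> vertices. Then the inner edges become few against \<open>k\<close>, next
  every vertex off an inner edge is good with threshold \<open>g2\<close>, and
  \<open>missing_ge_part\<close> applies.\<close>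

lemma nonpartite_book_free_edges_le:
  fixes p q :: nat and V :: "'a set"
  defines "\<beta> \<equiv> (2 * q + 4) * (100 * p * p * p)"
  assumes "3 \<le> p" "1 \<le> q" and finV: "finite V"
    and large: "100 * p * p * p * (\<beta> * \<beta> + \<beta> + q + 2) \<le> card V"
    and sym: "\<And>u v. R u v \<Longrightarrow> R v u" and irrefl: "\<And>v. \<not> R v v"
    and no_book: "\<not> has_book R V p q"
    and nonpartite: "\<And>c :: 'a \<Rightarrow> nat. (\<And>v. v \<in> V \<Longrightarrow> c v < p) \<Longrightarrow> \<exists>u\<in>V. \<exists>v\<in>V. R u v \<and> c u = c v"
  shows "int (pc R V V) \<le> turan2 (card V) p - 2 * int (card V div p) + 2"
proof (rule ccontr)
  assume neg: "\<not> ?thesis"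
  define n where "n = card V"
  define k where "k = n div p"
  \<comment> \<open>\<open>D\<close> is large enough for \<open>100 * p * p * g \<le> k\<close>, and
    \<open>\<beta> = (2 * q + 4) * D\<close> gives
    \<open>(2 * q + 4) * n \<le> \<beta> * Suc g\<close>.\<close>
  define D where "D = 100 * p * p * p"
  define g where "g = n div D"
  define I where "I c = pc (\<lambda>u v. c u = c v \<and> R u v) V V" for c :: "'a \<Rightarrow> nat"
  define M where "M c = pc (\<lambda>u v. c u \<noteq> c v \<and> \<not> R u v) V V" for c :: "'a \<Rightarrow> nat"
  define K where "K c = pc (\<lambda>u v. c u \<noteq> c v) V V" for c :: "'a \<Rightarrow> nat"
  have E: "turan2 n p - 2 * int k + 3 \<le> int (pc R V V)" using neg by (simp add: n_def k_def)
  have balance: "pc R V V + M c = K c + I c" for c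
    unfolding M_def K_def I_def by (rule pc_edge_balance) (rule finV)
  have K: "int (K c) \<le> turan2 n p" if "\<And>v. v \<in> V \<Longrightarrow> c v < p" for c
  proof -
    have "0 \<le> (\<Sum>i<p. (int (card {v \<in> V. c v = i}) - int (card V div p))
        * (int (card {v \<in> V. c v = i}) - int (card V div p) - 1))"
      by (intro sum_nonneg consecutive_prod_nonneg)
    then show ?thesis
      unfolding K_def n_def using pc_multipartite_turan2[of V c p, OF finV that] by linarith
  qed
  obtain c0 where c0: "\<forall>v\<in>V. c0 v < p" "pc R V V + I c0 \<le> K c0 + 2 * q * n"
    using book_free_stability[of R V "p - 1" q, OF sym irrefl finV] no_book \<open>3 \<le> p\<close>
    by (auto simp: I_def K_def n_def)
  obtain c where c: "\<forall>v\<in>V. c v < p" and min: "\<And>c'. \<forall>v\<in>V. c' v < p \<Longrightarrow> I c \<le> I c'"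
    using ex_has_least_nat[of "\<lambda>c. \<forall>v\<in>V. c v < p" c0 I] c0 by blast
  interpret coloured_book_free_graph V R c p q
    by unfold_locales (use finV sym irrefl c no_book \<open>1 \<le> q\<close> in auto)
  interpret optimally_coloured_graph V R c p q
  proof
    fix w j assume w: "w \<in> V" "j < p"
    let ?c = "c(w := j)"
    have "I c \<le> I ?c" using c w by (intro min) auto
    moreover have "I c = pc (\<lambda>u v. c u = c v \<and> R u v) (V - {w}) (V - {w}) + 2 * card (nbs {w} (c w))"
      unfolding I_def by (subst pc_inner_remove[OF finV w(1) sym irrefl]) (auto simp: nbs_def)
    moreover have "{v \<in> V. ?c v = ?c w \<and> R w v} = nbs {w} j"
      using irrefl by (auto simp: nbs_def)
    then have "I ?c = pc (\<lambda>u v. ?c u = ?c v \<and> R u v) (V - {w}) (V - {w}) + 2 * card (nbs {w} j)"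
      unfolding I_def by (subst pc_inner_remove[OF finV w(1) sym irrefl]) simp_all
    moreover have "pc (\<lambda>u v. ?c u = ?c v \<and> R u v) (V - {w}) (V - {w})
        = pc (\<lambda>u v. c u = c v \<and> R u v) (V - {w}) (V - {w})"
      by (rule pc_cong) auto
    ultimately show "card (nbs {w} (c w)) \<le> card (nbs {w} j)" by simp
  qed
  have inner_eq: "card inner = I c" and missing_eq: "card missing = M c"
    by (simp_all add: inner_def missing_def I_def M_def pc_def)
  have MI: "M c + 3 \<le> I c + 2 * k" using E K[of c] balance[of c] c by simp
  \<comment> \<open>By minimality \<open>I c \<le> I c0\<close>, where \<open>c0\<close> comes from
    stability, and the number of ordered edges is less than \<open>2 * k\<close> below
    \<open>turan2 n p\<close>.\<close>
  have "I c \<le> 2 * k + 2 * q * n"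
    using E K[of c0] c0 min[of c0] by (auto simp: of_nat_mult [symmetric] simp del: of_nat_mult)
  moreover have "k \<le> n" by (simp add: k_def)
  ultimately have M_le: "M c \<le> (2 * q + 4) * n" and I_le: "I c + 2 * k \<le> (2 * q + 4) * n"
    using MI by (auto simp: algebra_simps)
  have "0 < D" using \<open>3 \<le> p\<close> by (simp add: D_def)
  have "\<beta> * \<beta> + \<beta> + q + 2 \<le> g"
    using large \<open>0 < D\<close> by (simp add: g_def n_def less_eq_div_iff_mult_less_eq D_def mult.commute)
  then have g: "\<beta> * \<beta> \<le> g" "\<beta> < g" "q \<le> g" "2 \<le> g" "\<beta> * \<beta> + \<beta> + q + 2 \<le> g" by auto
  have "n < D * Suc g" using \<open>0 < D\<close> by (simp add: g_def dividend_less_times_div)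
  then have n_le: "(2 * q + 4) * n \<le> \<beta> * Suc g"
    unfolding \<beta>_def D_def[symmetric] by (simp only: mult.assoc mult_le_mono2 less_imp_le)
  have bad: "card (bad g) \<le> \<beta>"
  proof -
    have "card (bad g) * Suc g \<le> \<beta> * Suc g"
      using card_bad_le[of g] M_le n_le missing_eq by linarith
    then show ?thesis by (simp only: mult_le_cancel2)
  qed
  \<comment> \<open>A class smaller by more than \<open>g\<close> would cost at least
    \<open>Suc g * Suc g\<close> cross pairs, while the budget is \<open>\<beta> * Suc g\<close>
    with \<open>\<beta> < g\<close>.\<close>
  have part: "k - g \<le> card (part i)" if "i < p" for i
  proof (rule ccontr)
    assume "\<not> ?thesis"
    then have less: "int (Suc g) \<le> int k - int (card (part i))" by linarith
    have "int (Suc g) * int (Suc g) \<le> (int k - int (card (part i))) * (int k - int (card (part i)) + 1)"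
      using less by (intro mult_mono) auto
    also have "\<dots> = (int (card (part i)) - int k) * (int (card (part i)) - int k - 1)"
      by (simp add: algebra_simps)
    also have "\<dots> \<le> turan2 n p - int (K c)"
      using consecutive_sum_ge[OF that, of "\<lambda>i. int (card (part i))" "int k"]
        pc_multipartite_turan2[OF finV, of c p] c
      by (simp add: K_def n_def k_def part_def)
    also have "\<dots> \<le> int (I c + 2 * k)" using E balance[of c] by simp
    also have "\<dots> \<le> int (\<beta> * Suc g)" using I_le n_le by linarith
    finally have "Suc g * Suc g \<le> \<beta> * Suc g" by (metis of_nat_le_iff of_nat_mult)
    then have "Suc g \<le> \<beta>" by (simp only: mult_le_cancel2)
    with g show False by simp
  qed
  \<comment> \<open>With names for \<open>p * g\<close> and \<open>p * p * g\<close>, the remaining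
    numerical conditions become linear.\<close>
  define x where "x = p * g"
  define y where "y = p * x"
  have "3 * g \<le> x" "3 * x \<le> y" using \<open>3 \<le> p\<close> by (simp_all add: x_def y_def)
  have "g * D \<le> n" by (simp add: g_def)
  then have "100 * y * p \<le> n" by (simp add: D_def x_def y_def algebra_simps)
  then have k: "100 * y \<le> k"
    using \<open>3 \<le> p\<close> by (simp add: k_def less_eq_div_iff_mult_less_eq)
  note bounds = k \<open>3 * g \<le> x\<close> \<open>3 * x \<le> y\<close> g
  have p2: "2 \<le> p" using \<open>3 \<le> p\<close> by simp
  have "card inner \<le> \<beta> * \<beta> + 4 * (p * g + q + \<beta>)"
    by (rule card_inner_le[where k = k, OF bad p2 part])
      (use bounds MI inner_eq missing_eq in \<open>auto simp: x_def[symmetric]\<close>)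
  then have I: "I c \<le> \<beta> * \<beta> + 4 * x + 4 * q + 4 * \<beta>" by (simp add: inner_eq x_def)
  \<comment> \<open>After halving, the inner edges contribute \<open>2 * x\<close> and the common
    neighbours \<open>x\<close>; \<open>10 * g\<close> absorbs the rest.\<close>
  define g2 where "g2 = 3 * x + 10 * g"
  have good: "card (miss v) \<le> g2" if "(a, b) \<in> inner" "v \<in> V" "v \<notin> {a, b}" for a b v
  proof -
    have "2 * (k - g + card (miss v)) \<le> card missing + 2 * (p * g + q + \<beta>) + 4"
      by (rule miss_le_of_inner_edge[OF bad p2 that part])
    then have "2 * (k - g) + 2 * card (miss v) \<le> M c + 2 * x + 2 * q + 2 * \<beta> + 4"
      by (simp add: missing_eq x_def)
    moreover have "k = (k - g) + g" using bounds by simp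
    ultimately show ?thesis using I MI bounds unfolding g2_def by linarith
  qed
  have pg2: "p * g2 = 3 * y + 10 * x" by (simp add: g2_def x_def y_def algebra_simps)
  obtain a b where ab: "(a, b) \<in> inner" using nonpartite[of c] c by (auto simp: inner_def)
  have "\<exists>i<p. 2 * card (part i) + card inner \<le> card missing + 2"
    by (rule missing_ge_part[OF \<open>3 \<le> p\<close> ab good part])
      (use bounds I MI in \<open>auto simp: pg2 missing_eq, auto simp: g2_def\<close>)
  then obtain i where i: "i < p" "2 * card (part i) + I c \<le> M c + 2"
    by (auto simp: inner_eq missing_eq)
  let ?a = "int (card (part i)) - int k"
  \<comment> \<open>Imbalance compensates for a class below size \<open>k\<close>: since
    \<open>?a * (?a + 1) \<ge> 0\<close>, the loss against \<open>turan2 n p\<close> is at least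
    \<open>- 2 * ?a\<close>, so \<open>k\<close> may replace \<open>card (part i)\<close> in the
    final bound.\<close>
  have "- 2 * ?a \<le> ?a * (?a - 1)" using consecutive_prod_nonneg[of "?a + 1"] by (simp add: algebra_simps)
  also have "\<dots> \<le> turan2 n p - int (K c)"
    using consecutive_sum_ge[OF i(1), of "\<lambda>i. int (card (part i))" "int k"]
      pc_multipartite_turan2[OF finV, of c p] c
    by (simp add: K_def n_def k_def part_def)
  finally show False using E i(2) balance[of c] by simp
qed

section \<open>The graph \<open>Y_p(n)\<close>\<close>

lemma graph_on_adj:
  assumes "graph_on n E" "{u, v} \<in> E"
  shows "u < n \<and> v < n \<and> u \<noteq> v"
proof -
  have "{u, v} \<in> {{u, v} | u v. u \<noteq> v \<and> u < n \<and> v < n}"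
    using assms unfolding graph_on_def by blast
  then obtain a b where "{u, v} = {a, b}" "a \<noteq> b" "a < n" "b < n" by blast
  then show ?thesis by (metis doubleton_eq_iff)
qed

lemma pc_eq_twice_card_edges:
  assumes "graph_on n E"
  shows "pc (\<lambda>u v. {u, v} \<in> E) {..<n} {..<n} = 2 * card E"
proof -
  have "E \<subseteq> Pow {..<n}" using assms by (auto simp: graph_on_def)
  then have finE: "finite E" by (rule finite_subset) simp
  have two: "finite {(u, v). {u, v} = e} \<and> card {(u, v). {u, v} = e} = 2" if "e \<in> E" for e
  proof -
    have "e \<in> {{u, v} | u v. u \<noteq> v \<and> u < n \<and> v < n}"
      using assms that unfolding graph_on_def by blast
    then obtain a b where ab: "e = {a, b}" "a \<noteq> b" by blast
    have "{(u, v). {u, v} = e} = {(a, b), (b, a)}" unfolding ab(1) doubleton_eq_iff by auto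
    then show ?thesis using ab(2) by simp
  qed
  have "{(u, v). u \<in> {..<n} \<and> v \<in> {..<n} \<and> {u, v} \<in> E} = (\<Union>e\<in>E. {(u, v). {u, v} = e})"
    using graph_on_adj[OF assms] by auto
  then have "pc (\<lambda>u v. {u, v} \<in> E) {..<n} {..<n} = card (\<Union>e\<in>E. {(u, v). {u, v} = e})"
    by (simp add: pc_def)
  also have "\<dots> = (\<Sum>e\<in>E. card {(u, v). {u, v} = e})"
    using finE two by (intro card_UN_disjoint) auto
  also have "\<dots> = 2 * card E" using two by simp
  finally show ?thesis .
qed

lemma contains_book_of_has_book:
  assumes "has_book (\<lambda>u v. {u, v} \<in> E) {..<n} p q"
  shows "contains_book n p q E"
proof -
  obtain S T where ST: "S \<subseteq> {..<n}" "T \<subseteq> {..<n}" "finite S" "finite T" "card S = p" "card T = q"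
    "S \<inter> T = {}" "\<forall>x\<in>S. \<forall>y\<in>S \<union> T. x \<noteq> y \<longrightarrow> {x, y} \<in> E"
    using assms unfolding has_book_def by blast
  obtain h where h: "bij_betw h {0..<p} S" using ex_bij_betw_nat_finite[OF ST(3)] ST(5) by blast
  obtain k where k: "bij_betw k {0..<q} T" using ex_bij_betw_nat_finite[OF ST(4)] ST(6) by blast
  define f where "f i = (if i < p then h i else k (i - p))" for i
  have fS: "f i \<in> S" if "i < p" for i
    using that bij_betwE[OF h] by (auto simp: f_def)
  have fT: "f i \<in> T" if "p \<le> i" "i < p + q" for i
    using that bij_betwE[OF k] by (auto simp: f_def)
  have inj: "inj_on f {0..<p + q}"
  proof (rule inj_onI)
    fix i j assume ij: "i \<in> {0..<p + q}" "j \<in> {0..<p + q}" "f i = f j"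
    have "i < p \<longleftrightarrow> j < p" using ij fS fT ST(7) by (metis atLeastLessThan_iff disjoint_iff not_le)
    show "i = j"
    proof (cases "i < p")
      case True
      then have "h i = h j" "j < p" using ij(3) \<open>i < p \<longleftrightarrow> j < p\<close> by (simp_all add: f_def)
      then show ?thesis using True inj_onD[OF bij_betw_imp_inj_on[OF h], of i j] by simp
    next
      case False
      then have "k (i - p) = k (j - p)" "\<not> j < p"
        using ij(3) \<open>i < p \<longleftrightarrow> j < p\<close> by (simp_all add: f_def)
      then have "i - p = j - p"
        using False ij(1,2) inj_onD[OF bij_betw_imp_inj_on[OF k], of "i - p" "j - p"] by auto
      then show ?thesis using False \<open>\<not> j < p\<close> by simp
    qed
  qed
  have mem: "f i \<in> S \<union> T" if "i < p + q" for i using that fS fT by (cases "i < p") auto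
  show ?thesis unfolding contains_book_def
  proof (intro exI[of _ f] conjI allI impI)
    show "f ` {0..<p + q} \<subseteq> {0..<n}" using mem ST(1,2) by fastforce
    fix i j assume ij: "i < p \<and> j < p + q \<and> i \<noteq> j"
    then have "f i \<noteq> f j" using inj_onD[OF inj, of i j] by auto
    then show "{f i, f j} \<in> E" using ij fS mem ST(8) by simp
  qed (rule inj)
qed

lemma contains_book_mono:
  assumes "contains_book n p q E" "r \<le> q"
  shows "contains_book n p r E"
proof -
  obtain f where f: "inj_on f {0..<p + q}" "f ` {0..<p + q} \<subseteq> {0..<n}"
    "\<forall>i j. i < p \<and> j < p + q \<and> i \<noteq> j \<longrightarrow> {f i, f j} \<in> E"
    using assms unfolding contains_book_def by blast
  have sub: "{0..<p + r} \<subseteq> {0..<p + q}" using assms(2) by auto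
  have "inj_on f {0..<p + r}" using f(1) sub by (rule inj_on_subset)
  moreover have "f ` {0..<p + r} \<subseteq> {0..<n}" using f(2) sub by blast
  moreover have "\<forall>i j. i < p \<and> j < p + r \<and> i \<noteq> j \<longrightarrow> {f i, f j} \<in> E"
    using f(3) assms(2) by auto
  ultimately show ?thesis unfolding contains_book_def by blast
qed

lemma edges_le_turan2:
  assumes "3 \<le> p" "1 \<le> q"
  shows "\<exists>N. \<forall>n\<ge>N. \<forall>E. graph_on n E \<and> non_p_partite n p E \<and> book_free n p q E
    \<longrightarrow> 2 * int (card E) \<le> turan2 n p - 2 * int (n div p) + 2"
proof (intro exI allI impI)
  define \<beta> where "\<beta> = (2 * q + 4) * (100 * p * p * p)"
  fix n E
  assume n: "100 * p * p * p * (\<beta> * \<beta> + \<beta> + q + 2) \<le> n"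
    and E: "graph_on n E \<and> non_p_partite n p E \<and> book_free n p q E"
  have "int (pc (\<lambda>u v. {u, v} \<in> E) {..<n} {..<n})
      \<le> turan2 (card {..<n}) p - 2 * int (card {..<n} div p) + 2"
  proof (rule nonpartite_book_free_edges_le[OF assms])
    show "\<not> has_book (\<lambda>u v. {u, v} \<in> E) {..<n} p q"
      using E contains_book_of_has_book by (auto simp: book_free_def)
    show "\<exists>u\<in>{..<n}. \<exists>v\<in>{..<n}. {u, v} \<in> E \<and> c u = c v"
      if c: "\<And>v. v \<in> {..<n} \<Longrightarrow> c v < p" for c :: "nat \<Rightarrow> nat"
    proof -
      obtain u v where uv: "{u, v} \<in> E" "c u = c v"
        using E c unfolding non_p_partite_def p_partite_def by (meson lessThan_iff)
      then show ?thesis using graph_on_adj[of n E u v] E by auto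
    qed
    show "\<not> {v, v} \<in> E" for v using graph_on_adj[of n E v v] E by blast
  qed (use n in \<open>simp_all add: \<beta>_def insert_commute\<close>)
  then show "2 * int (card E) \<le> turan2 n p - 2 * int (n div p) + 2"
    using pc_eq_twice_card_edges[of n E] E by simp
qed

section \<open>Adjacency in \<open>Y_p(n)\<close>\<close>

text \<open>This form extends to \<open>v = 0\<close> with value \<open>p - 1\<close>, the class of
  \<open>u_1\<close>.\<close>

lemma tpart_add:
  assumes "1 \<le> v" "1 \<le> p"
  shows "tpart p v = (v + p - 1) mod p"
proof -
  have "v + p - 1 = (v - 1) + p" using assms by simp
  then show ?thesis unfolding tpart_def by (metis mod_add_self2)
qed

lemma tpart_values:
  assumes "2 \<le> p"
  shows "tpart p p = p - 1" "tpart p (p - 1) = p - 2"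
    "tpart p (2 * p) = p - 1" "tpart p (2 * p - 1) = p - 2"
proof -
  show "tpart p p = p - 1" "tpart p (p - 1) = p - 2" using assms by (simp_all add: tpart_def)
  have "2 * p - 1 = (p - 1) + p" "2 * p - 1 - 1 = (p - 2) + p" using assms by auto
  then show "tpart p (2 * p) = p - 1" "tpart p (2 * p - 1) = p - 2"
    using assms by (simp_all only: tpart_def mod_add_self2) simp_all
qed

lemma Y_graph_cases:
  assumes "e \<in> Y_graph p n"
  obtains (turan) a b where "e = {a, b}" "1 \<le> a" "a < n" "1 \<le> b" "b < n"
      "tpart p a \<noteq> tpart p b" "{a, b} \<noteq> {p, p - 1}"
    | (zero) v where "e = {0, v}" "1 \<le> v" "v < n"
      "tpart p v \<noteq> p - 1 \<and> tpart p v \<noteq> p - 2 \<or> v = p \<or> v = p - 1"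
  using assms unfolding Y_graph_def by blast

lemma Y_graph_adj_iff:
  assumes "1 \<le> u" "1 \<le> v"
  shows "{u, v} \<in> Y_graph p n \<longleftrightarrow>
    u < n \<and> v < n \<and> tpart p u \<noteq> tpart p v \<and> {u, v} \<noteq> {p, p - 1}"
proof
  assume "{u, v} \<in> Y_graph p n"
  then show "u < n \<and> v < n \<and> tpart p u \<noteq> tpart p v \<and> {u, v} \<noteq> {p, p - 1}"
  proof (cases rule: Y_graph_cases)
    case (turan a b)
    then have "u = a \<and> v = b \<or> u = b \<and> v = a" by (simp add: doubleton_eq_iff)
    with turan show ?thesis by (metis insert_commute)
  next
    case (zero w)
    then show ?thesis using assms by (simp add: doubleton_eq_iff)
  qed
next
  assume "u < n \<and> v < n \<and> tpart p u \<noteq> tpart p v \<and> {u, v} \<noteq> {p, p - 1}"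
  then show "{u, v} \<in> Y_graph p n" using assms unfolding Y_graph_def by blast
qed

lemma Y_graph_adj_zero_iff:
  assumes "1 \<le> v"
  shows "{0, v} \<in> Y_graph p n \<longleftrightarrow>
    v < n \<and> (tpart p v \<noteq> p - 1 \<and> tpart p v \<noteq> p - 2 \<or> v = p \<or> v = p - 1)"
proof
  assume "{0, v} \<in> Y_graph p n"
  then show "v < n \<and> (tpart p v \<noteq> p - 1 \<and> tpart p v \<noteq> p - 2 \<or> v = p \<or> v = p - 1)"
  proof (cases rule: Y_graph_cases)
    case (turan a b)
    then show ?thesis by (simp add: doubleton_eq_iff)
  next
    case (zero w)
    then have "v = w" using assms by (simp add: doubleton_eq_iff)
    with zero show ?thesis by blast
  qed
next
  assume "v < n \<and> (tpart p v \<noteq> p - 1 \<and> tpart p v \<noteq> p - 2 \<or> v = p \<or> v = p - 1)"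
  then show "{0, v} \<in> Y_graph p n" using assms unfolding Y_graph_def by blast
qed

lemma graph_on_Y_graph:
  assumes "2 \<le> p" "p < n"
  shows "graph_on n (Y_graph p n)"
proof -
  have "\<exists>u v. e = {u, v} \<and> u \<noteq> v \<and> u < n \<and> v < n" if "e \<in> Y_graph p n" for e
    using that
  proof (cases rule: Y_graph_cases)
    case (turan a b)
    then show ?thesis by metis
  next
    case (zero v)
    then have "0 \<noteq> v" "0 < n" by auto
    with zero show ?thesis by blast
  qed
  then show ?thesis unfolding graph_on_def by blast
qed

text \<open>The vertices \<open>0, p, 2p - 1, 2p, p - 1\<close> form a 5-cycle which is completely joined to the
  clique \<open>1, \<dots>, p - 2\<close>.\<close>

lemma non_p_partite_Y_graph:
  assumes "3 \<le> p" "2 * p < n"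
  shows "non_p_partite n p (Y_graph p n)"
  unfolding non_p_partite_def
proof
  assume "p_partite n p (Y_graph p n)"
  then obtain c where c: "\<And>v. v < n \<Longrightarrow> c v < p" "\<And>u v. {u, v} \<in> Y_graph p n \<Longrightarrow> c u \<noteq> c v"
    unfolding p_partite_def by blast
  let ?X = "{1..p - 2}"
  have p2: "2 \<le> p" using assms by simp
  note tp = tpart_values[OF p2]
  have X: "1 \<le> x" "x < n" "x \<noteq> p" "x \<noteq> p - 1" "tpart p x \<noteq> p - 1" "tpart p x \<noteq> p - 2"
      "tpart p x = x - 1" if "x \<in> ?X" for x
    using that assms by (auto simp: tpart_def)
  have "inj_on c ?X"
  proof (rule inj_onI, rule ccontr)
    fix x y assume xy: "x \<in> ?X" "y \<in> ?X" "c x = c y" "x \<noteq> y"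
    then have "tpart p x \<noteq> tpart p y" 
      using X(1,7)[OF xy(1)] X(1,7)[OF xy(2)] by simp
    then have "{x, y} \<in> Y_graph p n"
      using X[of x] X[of y] xy by (simp add: Y_graph_adj_iff doubleton_eq_iff)
    with c(2) xy show False by blast
  qed
  then have "card (c ` ?X) = p - 2" by (simp add: card_image)
  moreover have "c ` ?X \<subseteq> {..<p}" using c(1) X by auto
  \<comment> \<open>The clique leaves only two colours for the 5-cycle, which is odd.\<close>
  ultimately have "card ({..<p} - c ` ?X) = 2"
    using assms by (simp add: card_Diff_subset)
  then obtain \<alpha> \<gamma> where two: "{..<p} - c ` ?X = {\<alpha>, \<gamma>}" by (meson card_2_iff)
  have free: "c v \<in> {\<alpha>, \<gamma>}" if "v < n" "\<And>x. x \<in> ?X \<Longrightarrow> {x, v} \<in> Y_graph p n" for v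
    unfolding two[symmetric] using that c by fastforce
  let ?W = "{p, p - 1, 2 * p, 2 * p - 1}"
  have W: "1 \<le> p - 1" "p - 1 < n" "p < n" "1 \<le> 2 * p - 1" "2 * p - 1 < n" "p - 1 \<noteq> p - 2"
      "2 * p - 1 \<noteq> p" "2 * p - 1 \<noteq> p - 1" "2 * p \<noteq> p - 1" "2 * p \<noteq> p" "1 \<le> p" "1 \<le> 2 * p"
    using assms by simp_all
  have W': "1 \<le> v \<and> v < n \<and> (tpart p v = p - 1 \<or> tpart p v = p - 2)" if "v \<in> ?W" for v
    using that W tp assms by blast
  have "{x, v} \<in> Y_graph p n" if "x \<in> ?X" "v \<in> ?W" for x v
  proof -
    have "tpart p x \<noteq> tpart p v" using X[OF that(1)] W'[OF that(2)] by metis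
    then show ?thesis
      using X[OF that(1)] W'[OF that(2)] by (simp add: Y_graph_adj_iff doubleton_eq_iff)
  qed
  then have 1: "c v \<in> {\<alpha>, \<gamma>}" if "v \<in> ?W" for v
    using that W' by (intro free) blast+
  have "{x, 0} \<in> Y_graph p n" if "x \<in> ?X" for x
    using X[OF that] by (simp add: insert_commute[of x 0] Y_graph_adj_zero_iff)
  then have 2: "c 0 \<in> {\<alpha>, \<gamma>}" using assms by (intro free) auto
  have "{0, p} \<in> Y_graph p n" "{0, p - 1} \<in> Y_graph p n"
    using W by (simp_all add: Y_graph_adj_zero_iff)
  moreover have "{p, 2 * p - 1} \<in> Y_graph p n" "{2 * p - 1, 2 * p} \<in> Y_graph p n"
      "{2 * p, p - 1} \<in> Y_graph p n"
    using W tp assms(2) by (simp_all only: Y_graph_adj_iff doubleton_eq_iff) auto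
  ultimately have "c 0 \<noteq> c p" "c 0 \<noteq> c (p - 1)" "c p \<noteq> c (2 * p - 1)" "c (2 * p - 1) \<noteq> c (2 * p)"
      "c (2 * p) \<noteq> c (p - 1)"
    using c(2) by blast+
  moreover have "c p = \<alpha> \<or> c p = \<gamma>" "c (p - 1) = \<alpha> \<or> c (p - 1) = \<gamma>"
    "c (2 * p) = \<alpha> \<or> c (2 * p) = \<gamma>" "c (2 * p - 1) = \<alpha> \<or> c (2 * p - 1) = \<gamma>"
    "c 0 = \<alpha> \<or> c 0 = \<gamma>"
    using 1 2 by blast+
  ultimately show False by metis
qed

text \<open>\<open>B_{p,1}\<close> is \<open>K_{p+1}\<close>. Without \<open>u_0\<close> its
  vertices would need \<open>p + 1\<close> classes. With \<open>u_0\<close> the other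
  \<open>p\<close> vertices meet every class, so those in \<open>T_1\<close> and \<open>T_2\<close>
  are \<open>u_1\<close> and \<open>u_2\<close>, which are not adjacent.\<close>

lemma book_free_Y_graph:
  assumes "3 \<le> p"
  shows "book_free n p 1 (Y_graph p n)"
  unfolding book_free_def
proof
  assume "contains_book n p 1 (Y_graph p n)"
  then obtain f where f: "inj_on f {0..<p + 1}"
    "\<forall>i j. i < p \<and> j < p + 1 \<and> i \<noteq> j \<longrightarrow> {f i, f j} \<in> Y_graph p n"
    unfolding contains_book_def by blast
  have adj: "{f i, f j} \<in> Y_graph p n" if "i \<in> {0..<p + 1}" "j \<in> {0..<p + 1}" "i \<noteq> j" for i j
  proof (cases "i < p")
    case True
    then show ?thesis using f(2) that by simp
  next
    case False
    then have "{f j, f i} \<in> Y_graph p n" using f(2) that by simp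
    then show ?thesis by (simp add: insert_commute)
  qed
  have p2: "2 \<le> p" using assms by simp
  note tp = tpart_values[OF p2]
  have ne: "tpart p (f i) \<noteq> tpart p (f j) \<and> {f i, f j} \<noteq> {p, p - 1}"
    if "i \<in> {0..<p + 1}" "j \<in> {0..<p + 1}" "i \<noteq> j" "f i \<noteq> 0" "f j \<noteq> 0" for i j
    using adj[OF that(1-3)] that(4,5) by (subst (asm) Y_graph_adj_iff) auto
  have range: "tpart p v < p" for v using p2 by (simp add: tpart_def)
  have inj: "inj_on (\<lambda>i. tpart p (f i)) J" if "J \<subseteq> {0..<p + 1}" "\<And>j. j \<in> J \<Longrightarrow> f j \<noteq> 0" for J
    using that ne by (meson inj_onI subsetD)
  show False
  proof (cases "\<exists>i\<in>{0..<p + 1}. f i = 0")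
    case False
    then have "card ((\<lambda>i. tpart p (f i)) ` {0..<p + 1}) = p + 1"
      using inj[of "{0..<p + 1}"] by (subst card_image) auto
    moreover have "card ((\<lambda>i. tpart p (f i)) ` {0..<p + 1}) \<le> card {..<p}"
      using range by (intro card_mono) auto
    ultimately show False by simp
  next
    case True
    then obtain i where i: "i \<in> {0..<p + 1}" "f i = 0" by blast
    let ?J = "{0..<p + 1} - {i}"
    have nz: "f j \<noteq> 0" if "j \<in> ?J" for j
      using that i f(1) by (metis DiffD1 DiffD2 inj_onD insertI1)
    have "card ((\<lambda>i. tpart p (f i)) ` ?J) = card ?J"
      using inj[of ?J] nz by (intro card_image) auto
    also have "\<dots> = card {..<p}" using i by simp
    finally have "(\<lambda>i. tpart p (f i)) ` ?J = {..<p}"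
      using range by (intro card_subset_eq) auto
    moreover have "p - 1 \<in> {..<p}" "p - 2 \<in> {..<p}" using p2 by auto
    ultimately have "\<exists>j\<in>?J. p - 1 = tpart p (f j)" "\<exists>j\<in>?J. p - 2 = tpart p (f j)"
      by (metis (mono_tags, lifting) imageE)+
    then obtain j l where j: "j \<in> ?J" "tpart p (f j) = p - 1" and l: "l \<in> ?J" "tpart p (f l) = p - 2"
      by metis
    have "{0, f j} \<in> Y_graph p n" "{0, f l} \<in> Y_graph p n"
      using adj[of i j] adj[of i l] i j l by auto
    then have "f j \<in> {p, p - 1}" "f l \<in> {p, p - 1}"
      using nz[OF j(1)] nz[OF l(1)] j(2) l(2) by (simp_all add: Y_graph_adj_zero_iff)
    moreover have "p - 1 \<noteq> p - 2" using p2 by simp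
    ultimately have "f j = p" "f l = p - 1" using j(2) l(2) tp by auto
    moreover have "j \<noteq> l" using j(2) l(2) \<open>p - 1 \<noteq> p - 2\<close> by metis
    ultimately show False using ne[of j l] j(1) l(1) nz[OF j(1)] nz[OF l(1)] by simp
  qed
qed

section \<open>Counting the edges of \<open>Y_p(n)\<close>\<close>

lemma card_residue_class:
  assumes "s < (p :: nat)"
  shows "card {v. v < n \<and> v mod p = s} = n div p + (if s < n mod p then 1 else 0)"
proof (induction n)
  case 0
  show ?case by simp
next
  case (Suc n)
  have "{v. v < Suc n \<and> v mod p = s} = {v. v < n \<and> v mod p = s} \<union> (if n mod p = s then {n} else {})"
    by (auto simp: less_Suc_eq)
  then have "card {v. v < Suc n \<and> v mod p = s}
      = card {v. v < n \<and> v mod p = s} + (if n mod p = s then 1 else 0)"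
    by auto
  then show ?case using Suc assms mod_less_divisor[of p n] by (auto simp: mod_Suc div_Suc)
qed

lemma card_shifted_residue_class:
  assumes "r < p"
  shows "card {v. v < n \<and> (v + p - 1) mod p = r}
    = n div p + (if Suc r mod p < n mod p then 1 else 0)"
proof -
  have "(v + p - 1) mod p = r \<longleftrightarrow> v mod p = Suc r mod p" for v
  proof
    assume "(v + p - 1) mod p = r"
    then have "Suc r mod p = Suc (v + p - 1) mod p" by (metis mod_Suc_eq)
    then show "v mod p = Suc r mod p" using assms by simp
  next
    assume "v mod p = Suc r mod p"
    then have "(v + (p - 1)) mod p = (Suc r + (p - 1)) mod p" by (metis mod_add_left_eq)
    then show "(v + p - 1) mod p = r" using assms by simp
  qed
  then show ?thesis using assms card_residue_class[of "Suc r mod p" p n] by simp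
qed

text \<open>Placing \<open>u_0\<close> in the class of \<open>u_1\<close> makes \<open>c\<close> a
  balanced colouring of all \<open>n\<close> vertices. The edge \<open>u_0 u_1\<close> is inner;
  missing are at most \<open>u_1 u_2\<close> and the \<open>k - 1\<close> pairs from
  \<open>u_0\<close> to \<open>T_2\<close> without \<open>u_2\<close>.\<close>

lemma turan2_le_card_Y_graph:
  assumes "3 \<le> p" "2 * p < n"
  shows "turan2 n p - 2 * int (n div p) + 2 \<le> 2 * int (card (Y_graph p n))"
proof -
  define c where "c v = (v + p - 1) mod p" for v
  define k where "k = n div p"
  let ?V = "{..<n}"
  let ?R = "\<lambda>u v. {u, v} \<in> Y_graph p n"
  have p2: "2 \<le> p" using assms by simp
  note tp = tpart_values[OF p2]
  have c_pos: "c v = tpart p v" if "1 \<le> v" for v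
    using tpart_add[of v p] that p2 by (simp add: c_def)
  have c_0: "c 0 = p - 1" using p2 by (simp add: c_def)
  have class_set: "{v \<in> ?V. c v = i} = {v. v < n \<and> (v + p - 1) mod p = i}" for i
    by (auto simp: c_def)
  have "(int (card {v \<in> ?V. c v = i}) - int k) * (int (card {v \<in> ?V. c v = i}) - int k - 1) = 0"
    if "i < p" for i
    unfolding class_set card_shifted_residue_class[OF that] by (simp add: k_def)
  then have sum0: "(\<Sum>i<p. (int (card {v \<in> ?V. c v = i}) - int k)
      * (int (card {v \<in> ?V. c v = i}) - int k - 1)) = 0"
    by (intro sum.neutral) blast
  have "c v < p" for v using p2 by (simp add: c_def)
  then have K: "int (pc (\<lambda>u v. c u \<noteq> c v) ?V ?V) = turan2 n p"
    using pc_multipartite_turan2[of ?V c p] sum0 unfolding card_lessThan k_def[symmetric] by simp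
  have "card {(0, p), (p, 0)} \<le> pc (\<lambda>u v. c u = c v \<and> ?R u v) ?V ?V"
    unfolding pc_def using assms c_0 c_pos[of p] tp
    by (intro card_mono finite_pc)
      (auto simp: Y_graph_adj_zero_iff insert_commute[of p 0])
  then have I: "2 \<le> pc (\<lambda>u v. c u = c v \<and> ?R u v) ?V ?V" using p2 by simp
  define Q where "Q = {v \<in> ?V. c v = p - 2} - {p - 1}"
  \<comment> \<open>The shifted residue \<open>p - 1\<close> is never below \<open>n mod p\<close>,
    so \<open>T_2\<close> has exactly \<open>k\<close> vertices.\<close>
  have "Suc (p - 2) mod p = p - 1" using p2 by (simp add: Suc_diff_le)
  moreover have "n mod p \<le> p - 1" using mod_less_divisor[of p n] p2 by linarith
  ultimately have "card {v \<in> ?V. c v = p - 2} = k"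
    using card_shifted_residue_class[of "p - 2" p n] p2 unfolding class_set k_def by simp
  moreover have "p - 1 \<in> {v \<in> ?V. c v = p - 2}" using assms c_pos[of "p - 1"] tp by auto
  ultimately have Q: "card Q = k - 1" unfolding Q_def by (subst card_Diff_singleton) auto
  have "1 \<le> k" using assms by (simp add: k_def less_eq_div_iff_mult_less_eq)
  have miss: "(u, v) \<in> {0} \<times> Q \<union> Q \<times> {0} \<union> {(p, p - 1), (p - 1, p)}"
    if uv: "u < n" "v < n" "c u \<noteq> c v" "\<not> ?R u v" for u v
  proof (cases "u = 0 \<or> v = 0")
    case True
    have inQ: "w \<in> Q" if "w < n" "c w \<noteq> p - 1" "\<not> ?R 0 w" "w \<noteq> 0" for w
      using that c_pos[of w] by (auto simp: Q_def Y_graph_adj_zero_iff)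
    from True show ?thesis
    proof
      assume "u = 0"
      then have "v \<noteq> 0" using uv(3) by metis
      then have "v \<in> Q" using uv c_0 \<open>u = 0\<close> inQ[of v] by simp
      with \<open>u = 0\<close> show ?thesis by blast
    next
      assume "v = 0"
      then have "u \<noteq> 0" using uv(3) by metis
      then have "u \<in> Q" using uv c_0 \<open>v = 0\<close> inQ[of u] by (simp add: insert_commute)
      with \<open>v = 0\<close> show ?thesis by blast
    qed
  next
    case False
    then show ?thesis using uv c_pos by (simp add: Y_graph_adj_iff doubleton_eq_iff)
  qed
  have "finite Q" by (simp add: Q_def)
  have "pc (\<lambda>u v. c u \<noteq> c v \<and> \<not> ?R u v) ?V ?V
      \<le> card ({0 :: nat} \<times> Q \<union> Q \<times> {0 :: nat} \<union> {(p, p - 1), (p - 1, p)})"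
    unfolding pc_def using miss \<open>finite Q\<close> by (intro card_mono) auto
  also have "\<dots> \<le> card ({0 :: nat} \<times> Q) + card (Q \<times> {0 :: nat}) + card {(p, p - 1), (p - 1, p)}"
    using card_Un_le[of "{0 :: nat} \<times> Q \<union> Q \<times> {0 :: nat}" "{(p, p - 1), (p - 1, p)}"]
      card_Un_le[of "{0 :: nat} \<times> Q" "Q \<times> {0 :: nat}"] by linarith
  also have "\<dots> \<le> 2 * k"
    using Q \<open>1 \<le> k\<close> card_doubleton_le[of "(p, p - 1)" "(p - 1, p)"] by (simp add: card_cartesian_product)
  finally have M: "pc (\<lambda>u v. c u \<noteq> c v \<and> \<not> ?R u v) ?V ?V \<le> 2 * k" .
  have "pc ?R ?V ?V = 2 * card (Y_graph p n)"
    using graph_on_Y_graph assms by (intro pc_eq_twice_card_edges) auto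
  then show ?thesis using pc_edge_balance[of ?V ?R c] K I M by (simp add: k_def)
qed

theorem theorem1p3:
  fixes p q :: nat
  assumes "p \<ge> 3" and "q \<ge> 1"
  shows "\<exists>N. \<forall>n \<ge> N. Y_graph p n \<in> extremal n p 1 \<and> extremal n p 1 \<subseteq> extremal n p q"
proof -
  obtain N1 where N1: "\<And>n E. n \<ge> N1 \<Longrightarrow> graph_on n E \<Longrightarrow> non_p_partite n p E \<Longrightarrow>
      book_free n p 1 E \<Longrightarrow> 2 * int (card E) \<le> turan2 n p - 2 * int (n div p) + 2"
    using edges_le_turan2[OF assms(1), of 1] by auto
  obtain Nq where Nq: "\<And>n E. n \<ge> Nq \<Longrightarrow> graph_on n E \<Longrightarrow> non_p_partite n p E \<Longrightarrow>
      book_free n p q E \<Longrightarrow> 2 * int (card E) \<le> turan2 n p - 2 * int (n div p) + 2"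
    using edges_le_turan2[OF assms] by auto
  have "Y_graph p n \<in> extremal n p 1 \<and> extremal n p 1 \<subseteq> extremal n p q"
    if n: "n \<ge> max (max N1 Nq) (2 * p + 1)" for n
  proof -
    have Y: "graph_on n (Y_graph p n)" "non_p_partite n p (Y_graph p n)" "book_free n p 1 (Y_graph p n)"
      "turan2 n p - 2 * int (n div p) + 2 \<le> 2 * int (card (Y_graph p n))"
      using n assms graph_on_Y_graph non_p_partite_Y_graph book_free_Y_graph turan2_le_card_Y_graph
      by auto
    have "card E \<le> card (Y_graph p n)"
      if "graph_on n E" "non_p_partite n p E" "book_free n p 1 E" for E
      using N1[OF _ that] Y(4) n by simp
    \<comment> \<open>The upper bound is the same for \<open>q\<close> and for 1 and is attained by
      \<open>Y_p(n)\<close>, so both maxima agree; a graph without \<open>B_{p,1}\<close> contains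
      no \<open>B_{p,q}\<close>.\<close>
    moreover have "E \<in> extremal n p q" if E: "E \<in> extremal n p 1" for E
    proof -
      have E1: "graph_on n E" "non_p_partite n p E" "book_free n p 1 E" "card (Y_graph p n) \<le> card E"
        using E Y by (auto simp: extremal_def)
      have "card E' \<le> card E" if "graph_on n E'" "non_p_partite n p E'" "book_free n p q E'" for E'
        using Nq[OF _ that] Y(4) E1(4) n by simp
      moreover have "book_free n p q E"
        using E1(3) contains_book_mono assms(2) by (auto simp: book_free_def)
      ultimately show ?thesis using E1 by (auto simp: extremal_def)
    qed
    ultimately show ?thesis using Y by (auto simp: extremal_def)
  qed
  then show ?thesis by blast
qed

end
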